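(* Let $b$ be a locally integrable function on $\mathbb{R}^n$ and let $0<\beta<1$. Then the following assertions are equivalent: (1) $b\in \dot{\Lambda}_{\beta}(\mathbb{R}^n)$ and $b\ge 0$. (2) $[b,M^{\sharp}]$ is bounded from $L^{p(\cdot)}(\mathbb{R}^n)$ to $L^{q(\cdot)}(\mathbb{R}^n)$ for all $(p(\cdot),q(\cdot))\in \mathscr{B}_{p,q}^{\beta}(\mathbb{R}^n)$. (3) $[b,M^{\sharp}]$ is bounded from $L^{p(\cdot)}(\mathbb{R}^n)$ to $L^{q(\cdot)}(\mathbb{R}^n)$ for some $(p(\cdot),q(\cdot))\in \mathscr{B}_{p,q}^{\beta}(\mathbb{R}^n)$. (4) There exists some $(p(\cdot),q(\cdot))\in \mathscr{B}_{p,q}^{\beta}(\mathbb{R}^n)$ such that $$\sup_{Q} \frac1{|Q|^{\beta/n}}\frac{\|(b-2M^{\sharp}(b\chi_Q))\chi_Q\|_{L^{q(\cdot)}(\mathbb{R}^n)}}{\|\chi_Q\|_{L^{q(\cdot)}(\mathbb{R}^n)}} <\infty.$$ (5) For all $(p(\cdot),q(\cdot))\in \mathscr{B}_{p,q}^{\beta}(\mathbb{R}^n)$, $$\sup_{Q} \frac1{|Q|^{\beta/n}}\frac{\|(b-2M^{\sharp}(b\chi_Q))\chi_Q\|_{L^{q(\cdot)}(\mathbb{R}^n)}}{\|\chi_Q\|_{L^{q(\cdot)}(\mathbb{R}^n)}} <\infty.$$ In (4) and (5) the suprema are over all cubes $Q\subset\mathbb{R}^n$.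
   Context: Functions are real-valued and identified when equal almost everywhere; in particular $b\in\dot{\Lambda}_\beta(\mathbb{R}^n)$ means that $b$ agrees a.e. with a function satisfying the condition below, and $b\ge0$ is understood a.e. A cube $Q\subset\mathbb{R}^n$ always has sides parallel to the coordinate axes; $|Q|$ is its Lebesgue measure, $\chi_Q$ its characteristic function, and $f_Q=|Q|^{-1}\int_Q f(x)\,dx$ for $f\in L^1_{\rm loc}(\mathbb{R}^n)$. Lipschitz space: for $0<\beta<1$, $b\in\dot{\Lambda}_{\beta}(\mathbb{R}^n)$ if there is a constant $C$ with $|b(x)-b(y)|\le C|x-y|^{\beta}$ for all $x,y\in\mathbb{R}^n$. Hardy-Littlewood maximal function: $M(f)(x)=\sup_{Q\ni x}\frac1{|Q|}\int_Q|f(y)|\,dy$. Sharp maximal function: $M^{\sharp}(f)(x)=\sup_{Q\ni x}\frac1{|Q|}\int_Q|f(y)-f_Q|\,dy$. Both suprema are over all cubes $Q\subset\mathbb{R}^n$ containing $x$. The (nonlinear) commutator of $M^{\sharp}$ with $b$ is $[b,M^{\sharp}](f)=bM^{\sharp}(f)-M^{\sharp}(bf)$. Variable exponent Lebesgue space: for measurable $p(\cdot):\mathbb{R}^n\to[1,\infty)$, $L^{p(\cdot)}(\mathbb{R}^n)$ is the set of measurable $f$ with $\int_{\mathbb{R}^n}(|f(x)|/\lambda)^{p(x)}dx<\infty$ for some $\lambda>0$, with norm $\|f\|_{L^{p(\cdot)}(\mathbb{R}^n)}=\inf\{\lambda>0:\int_{\mathbb{R}^n}(|f(x)|/\lambda)^{p(x)}dx\le1\}$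 (equal to $\infty$ if $f\notin L^{p(\cdot)}(\mathbb{R}^n)$). An operator $T$ is bounded from $L^{p(\cdot)}(\mathbb{R}^n)$ to $L^{q(\cdot)}(\mathbb{R}^n)$ if there is a constant $C$ such that, for all $f\in L^{p(\cdot)}(\mathbb{R}^n)$, $Tf$ is defined a.e. and $\|Tf\|_{L^{q(\cdot)}(\mathbb{R}^n)}\le C\|f\|_{L^{p(\cdot)}(\mathbb{R}^n)}$. $\mathscr{P}(\mathbb{R}^n)$ is the set of measurable $p(\cdot):\mathbb{R}^n\to[1,\infty)$ with $1<p_-:=\operatorname{ess\,inf}_{x}p(x)$ and $p_+:=\operatorname{ess\,sup}_{x}p(x)<\infty$. $\mathscr{B}(\mathbb{R}^n)$ is the set of $p(\cdot)\in\mathscr{P}(\mathbb{R}^n)$ such that $M$ is bounded on $L^{p(\cdot)}(\mathbb{R}^n)$. An ordered pair $(p(\cdot),q(\cdot))$ of variable exponents belongs to $\mathscr{B}^{\alpha}_{p,q}(\mathbb{R}^n)$ if $p(\cdot)\in\mathscr{P}(\mathbb{R}^n)$, $0<\alpha<n/p_+$, $1/q(\cdot)=1/p(\cdot)-\alpha/n$, and $q(\cdot)(n-\alpha)/n\in\mathscr{B}(\mathbb{R}^n)$. *)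

theory Defs
  imports "HOL-Analysis.Analysis" "HOL-Probability.Essential_Supremum"
begin

text \<open>The space \<open>\<real>\<^sup>n\<close> is \<^typ>\<open>real ^ 'n\<close> with \<open>n = CARD('n)\<close>; all measurability, integrals and
  almost-everywhere statements refer to Lebesgue measure \<^const>\<open>lebesgue\<close>.\<close>

text \<open>Cubes are non-degenerate. They are taken to be open; since faces are null sets and mean values
  depend continuously on the cube, closed cubes would give the same suprema below.\<close>

definition cubes :: "(real ^ 'n) set set" where
  "cubes = {box a (\<chi> i. a $ i + l) | a l. 0 < l}"

definition locally_integrable :: "(real ^ 'n \<Rightarrow> real) \<Rightarrow> bool" where
  "locally_integrable f \<longleftrightarrow> (\<forall>K. compact K \<longrightarrow> set_integrable lebesgue K f)"

definition mean :: "(real ^ 'n) set \<Rightarrow> (real ^ 'n \<Rightarrow> real) \<Rightarrow> real" where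
  "mean Q f = (LINT y:Q|lebesgue. f y) / measure lebesgue Q"

definition lipschitz_space :: "real \<Rightarrow> (real ^ 'n \<Rightarrow> real) set" where
  "lipschitz_space \<beta> = {b. \<exists>g. (AE x in lebesgue. b x = g x) \<and>
     (\<exists>C. \<forall>x y. \<bar>g x - g y\<bar> \<le> C * norm (x - y) powr \<beta>)}"

definition maximal :: "(real ^ 'n \<Rightarrow> real) \<Rightarrow> real ^ 'n \<Rightarrow> ennreal" where
  "maximal f x = (SUP Q \<in> {Q \<in> cubes. x \<in> Q}.
     (\<integral>\<^sup>+y\<in>Q. ennreal \<bar>f y\<bar> \<partial>lebesgue) / emeasure lebesgue Q)"

text \<open>If a measurable \<open>f\<close> is not integrable on some cube, then it is not integrable on some cube
  containing \<open>x\<close>, for any given \<open>x\<close>; there \<^term>\<open>mean Q f = 0\<close>, so the oscillation of \<open>f\<close> over \<open>Q\<close> is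
  \<open>\<infinity>\<close>. So a sharp maximal function that does not make sense (\<open>f\<close> is not locally integrable) has the
  value \<open>\<infinity>\<close> everywhere.\<close>

definition sharp_maximal :: "(real ^ 'n \<Rightarrow> real) \<Rightarrow> real ^ 'n \<Rightarrow> ennreal" where
  "sharp_maximal f x = (SUP Q \<in> {Q \<in> cubes. x \<in> Q}.
     (\<integral>\<^sup>+y\<in>Q. ennreal \<bar>f y - mean Q f\<bar> \<partial>lebesgue) / emeasure lebesgue Q)"

text \<open>Operators map real functions to extended real functions; a value \<open>\<plusminus>\<infinity>\<close> at a point means that the
  real-valued function \<open>T f\<close> is not defined there. In particular \<^term>\<open>\<infinity> - \<infinity> = (\<infinity> :: ereal)\<close> counts as
  undefined.\<close>

definition commutator_sharp :: "(real ^ 'n \<Rightarrow> real) \<Rightarrow> (real ^ 'n \<Rightarrow> real) \<Rightarrow> real ^ 'n \<Rightarrow> ereal" where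
  "commutator_sharp b f x =
     ereal (b x) * enn2ereal (sharp_maximal f x) - enn2ereal (sharp_maximal (\<lambda>y. b y * f y) x)"

definition variable_exponent :: "(real ^ 'n \<Rightarrow> real) \<Rightarrow> bool" where
  "variable_exponent p \<longleftrightarrow> p \<in> borel_measurable lebesgue \<and> (\<forall>x. 1 \<le> p x)"

definition modular :: "(real ^ 'n \<Rightarrow> real) \<Rightarrow> (real ^ 'n \<Rightarrow> real) \<Rightarrow> real \<Rightarrow> ennreal" where
  "modular p f r = (\<integral>\<^sup>+x. ennreal ((\<bar>f x\<bar> / r) powr p x) \<partial>lebesgue)"

definition var_Lp :: "(real ^ 'n \<Rightarrow> real) \<Rightarrow> (real ^ 'n \<Rightarrow> real) set" where
  "var_Lp p = {f \<in> borel_measurable lebesgue. \<exists>r>0. modular p f r < \<infinity>}"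

definition var_norm :: "(real ^ 'n \<Rightarrow> real) \<Rightarrow> (real ^ 'n \<Rightarrow> real) \<Rightarrow> ennreal" where
  "var_norm p f =
     (if f \<in> var_Lp p then Inf {ennreal r | r. 0 < r \<and> modular p f r \<le> 1} else \<infinity>)"

definition finite_ae :: "(real ^ 'n \<Rightarrow> ereal) \<Rightarrow> bool" where
  "finite_ae F \<longleftrightarrow> (AE x in lebesgue. \<bar>F x\<bar> \<noteq> \<infinity>)"

text \<open>The norm of an extended real function, identified with a real function if it is finite almost
  everywhere.\<close>

definition var_norm_ereal :: "(real ^ 'n \<Rightarrow> real) \<Rightarrow> (real ^ 'n \<Rightarrow> ereal) \<Rightarrow> ennreal" where
  "var_norm_ereal p F = (if finite_ae F then var_norm p (\<lambda>x. real_of_ereal (F x)) else \<infinity>)"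

definition bounded_operator ::
    "((real ^ 'n \<Rightarrow> real) \<Rightarrow> real ^ 'n \<Rightarrow> ereal) \<Rightarrow> (real ^ 'n \<Rightarrow> real) \<Rightarrow> (real ^ 'n \<Rightarrow> real) \<Rightarrow> bool" where
  "bounded_operator T p q \<longleftrightarrow> (\<exists>C::real. \<forall>f \<in> var_Lp p.
     finite_ae (T f) \<and> var_norm_ereal q (T f) \<le> ennreal C * var_norm p f)"

definition ess_lower :: "(real ^ 'n \<Rightarrow> real) \<Rightarrow> ereal" where
  "ess_lower p = - esssup lebesgue (\<lambda>x. - ereal (p x))"

definition ess_upper :: "(real ^ 'n \<Rightarrow> real) \<Rightarrow> ereal" where
  "ess_upper p = esssup lebesgue (\<lambda>x. ereal (p x))"

definition exponents_P :: "(real ^ 'n \<Rightarrow> real) set" where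
  "exponents_P = {p. variable_exponent p \<and> 1 < ess_lower p \<and> ess_upper p < \<infinity>}"

definition exponents_B :: "(real ^ 'n \<Rightarrow> real) set" where
  "exponents_B = {p \<in> exponents_P. bounded_operator (\<lambda>f x. enn2ereal (maximal f x)) p p}"

definition exponent_pairs :: "real \<Rightarrow> ((real ^ 'n \<Rightarrow> real) \<times> (real ^ 'n \<Rightarrow> real)) set" where
  "exponent_pairs \<alpha> = {(p, q). variable_exponent q \<and> p \<in> exponents_P \<and>
     0 < \<alpha> \<and> ereal \<alpha> < ereal (real CARD('n)) / ess_upper p \<and>
     (AE x in lebesgue. 1 / q x = 1 / p x - \<alpha> / real CARD('n)) \<and>
     (\<lambda>x. q x * (real CARD('n) - \<alpha>) / real CARD('n)) \<in> exponents_B}"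

text \<open>The supremum over all cubes \<open>Q\<close> of
  \<open>|Q|\<^bsup>-\<beta>/n\<^esup> \<parallel>(b - 2 M\<^sup>\<sharp>(b \<chi>\<^sub>Q)) \<chi>\<^sub>Q\<parallel> / \<parallel>\<chi>\<^sub>Q\<parallel>\<close>, with norms in the space of exponent \<open>q\<close>.\<close>

definition sharp_deviation :: "real \<Rightarrow> (real ^ 'n \<Rightarrow> real) \<Rightarrow> (real ^ 'n \<Rightarrow> real) \<Rightarrow> ennreal" where
  "sharp_deviation \<beta> b q = (SUP Q \<in> cubes.
     1 / ennreal (measure lebesgue Q powr (\<beta> / real CARD('n))) *
     (var_norm_ereal q (\<lambda>x. (ereal (b x) - 2 * enn2ereal (sharp_maximal (\<lambda>y. b y * indicator Q y) x))
        * indicator Q x) / var_norm q (indicator Q)))"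

end

theory Submission
  imports Defs
begin

text \<open>
  Put \<open>n = CARD('n)\<close>, \<open>\<theta> = \<beta>/n\<close> and \<open>r = q (1 - \<theta>)\<close>, so that the maximal operator is bounded for the
  exponent \<open>r\<close>.

  If \<open>b \<ge> 0\<close> is Hoelder continuous, then \<open>b(x) M\<^sup>\<sharp>f(x)\<close> is the sharp maximal function of \<open>b(x) f\<close> at
  \<open>x\<close>, and it differs from that of \<open>b f\<close> by at most a multiple of the fractional maximal function of \<open>f\<close>;
  a Hoelder inequality with the exponents \<open>1/\<theta>\<close> and \<open>1/(1 - \<theta>)\<close> bounds the latter by a power of a maximal
  function in the space of exponent \<open>r\<close>. The values are finite almost everywhere because large cubes
  are controlled by the fractional maximal function and small ones by the weak type (1,1) estimate.

  Since \<open>M\<^sup>\<sharp>\<chi>\<^sub>Q = 1/2\<close> on \<open>Q\<close>, applying the commutator to \<open>\<chi>\<^sub>Q\<close> turns boundedness into the estimate for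
  \<open>h = (b - 2 M\<^sup>\<sharp>(b \<chi>\<^sub>Q)) \<chi>\<^sub>Q\<close>.

  Conversely that estimate yields \<open>|Q|\<^sup>-\<^sup>1 \<integral>\<^sub>Q |h| \<le> C |Q|\<^sup>\<theta>\<close>, as the maximal operator is also bounded for
  the exponent \<open>q\<close>. From \<open>|b\<^sub>Q| \<le> 2 M\<^sup>\<sharp>(b \<chi>\<^sub>Q)\<close> on \<open>Q\<close> one gets \<open>|b\<^sub>Q| - b \<le> |h|\<close>, hence both the mean
  oscillation of \<open>b\<close> and \<open>|b\<^sub>Q| - b\<^sub>Q\<close> are \<open>O(|Q|\<^sup>\<theta>)\<close>; Campanato's argument gives Hoelder continuity and
  letting \<open>Q\<close> shrink gives \<open>b \<ge> 0\<close>.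

  All exponent pairs are covered by the same argument; one exists because \<open>M\<close> is bounded on \<open>L\<^sup>2\<close>.
\<close>

section \<open>Cubes and the weak type (1,1) estimate\<close>

definition cube :: "real ^ 'n \<Rightarrow> real \<Rightarrow> (real ^ 'n) set" where
  "cube a l = box a (\<chi> i. a $ i + l)"

text \<open>An \<open>ennreal\<close> value makes averages meaningful without integrability: for a
  cube, \<open>avg Q f\<close> is \<infinity> exactly when the integral of |f| over it is. Real
  means need integrability and are treated separately by \<open>mean\<close>.\<close>

definition avg :: "(real ^ 'n) set \<Rightarrow> (real ^ 'n \<Rightarrow> real) \<Rightarrow> ennreal" where
  "avg Q f = (\<integral>\<^sup>+y\<in>Q. ennreal \<bar>f y\<bar> \<partial>lebesgue) / emeasure lebesgue Q"

lemma mem_cube: "x \<in> cube a l \<longleftrightarrow> (\<forall>i. a $ i < x $ i \<and> x $ i < a $ i + l)"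
  by (auto simp: cube_def mem_box_cart)

lemma cubes_eq: "cubes = {cube a l | a l. 0 < l}"
  by (simp add: cubes_def cube_def)

lemma cubesE:
  assumes "Q \<in> cubes" obtains a l where "0 < l" "Q = cube a l"
  using assms by (auto simp: cubes_eq)

lemma cube_in_cubes: "0 < l \<Longrightarrow> cube a l \<in> cubes"
  by (auto simp: cubes_eq)

lemma open_cubes: "Q \<in> cubes \<Longrightarrow> open Q"
  by (auto simp: cubes_def)

lemma sets_cubes: "Q \<in> cubes \<Longrightarrow> Q \<in> sets lebesgue"
  by (rule sets_completionI_sets) (simp add: open_cubes borel_open)

lemma emeasure_cube:
  fixes a :: "real ^ 'n"
  assumes "0 \<le> l" shows "emeasure lebesgue (cube a l) = ennreal (l ^ CARD('n))"
proof -
  have "(\<Prod>b\<in>(Basis::(real^'n) set). ((\<chi> i. a $ i + l) - a) \<bullet> b) = (\<Prod>b\<in>(Basis::(real^'n) set). l)"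
  proof (rule prod.cong)
    fix b :: "real^'n" assume "b \<in> Basis"
    then obtain i where "b = axis i 1" by (auto simp: Basis_vec_def)
    then show "((\<chi> i. a $ i + l) - a) \<bullet> b = l" by (simp add: inner_axis)
  qed simp
  moreover have "a \<bullet> b \<le> (\<chi> i. a $ i + l) \<bullet> b" if "b \<in> Basis" for b
  proof -
    obtain i where "b = axis i 1" using \<open>b \<in> Basis\<close> by (auto simp: Basis_vec_def)
    then show ?thesis using assms by (simp add: inner_axis)
  qed
  ultimately show ?thesis
    by (simp add: cube_def emeasure_lborel_box)
qed

lemma measure_cube:
  fixes a :: "real ^ 'n"
  assumes "0 \<le> l" shows "measure lebesgue (cube a l) = l ^ CARD('n)"
  using emeasure_cube[OF assms, of a] assms by (simp add: measure_def)

lemma emeasure_cubes_pos: "Q \<in> cubes \<Longrightarrow> 0 < emeasure lebesgue Q"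
  by (auto simp: emeasure_cube elim!: cubesE)

lemma emeasure_cubes_finite: "Q \<in> cubes \<Longrightarrow> emeasure lebesgue Q < \<infinity>"
  by (auto simp: emeasure_cube elim!: cubesE)

lemma measure_cubes_pos: "Q \<in> cubes \<Longrightarrow> 0 < measure lebesgue Q"
  by (auto simp: measure_cube elim!: cubesE)

lemma emeasure_cubes: "Q \<in> cubes \<Longrightarrow> emeasure lebesgue Q = ennreal (measure lebesgue Q)"
  using emeasure_cubes_finite[of Q] by (intro emeasure_eq_ennreal_measure) auto

lemma nn_integral_eq_avg:
  "Q \<in> cubes \<Longrightarrow> (\<integral>\<^sup>+y\<in>Q. ennreal \<bar>f y\<bar> \<partial>lebesgue) = avg Q f * emeasure lebesgue Q"
  using emeasure_cubes_pos[of Q] emeasure_cubes_finite[of Q]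
  by (simp add: avg_def ennreal_divide_times ennreal_divide_self)

lemma maximal_eq: "maximal f x = (SUP Q \<in> {Q \<in> cubes. x \<in> Q}. avg Q f)"
  by (simp add: maximal_def avg_def)

lemma avg_le_maximal: "Q \<in> cubes \<Longrightarrow> x \<in> Q \<Longrightarrow> avg Q f \<le> maximal f x"
  unfolding maximal_eq by (rule SUP_upper) auto

text \<open>A point lies in the superlevel set iff some cube with value above t contains it, so this
  set is a union of open cubes. The set function is arbitrary, which covers \<open>maximal\<close>
  and \<open>sharp_maximal\<close> at once.\<close>

lemma open_Sup_cubes: "open {x. t < (SUP Q \<in> {Q \<in> cubes. x \<in> Q}. (\<phi> Q :: ennreal))}"
proof -
  have "{x. t < (SUP Q \<in> {Q \<in> cubes. x \<in> Q}. \<phi> Q)} = \<Union> {Q \<in> cubes. t < \<phi> Q}"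
    by (auto simp: less_SUP_iff)
  then show ?thesis by (auto intro: open_cubes)
qed

lemma borel_Sup_cubes [measurable]:
  "(\<lambda>x. SUP Q \<in> {Q \<in> cubes. x \<in> Q}. (\<phi> Q :: ennreal)) \<in> borel_measurable borel"
  by (rule borel_measurableI_greater) (simp add: open_Sup_cubes borel_open)

lemma borel_measurable_maximal: "maximal f \<in> borel_measurable borel"
  using borel_Sup_cubes[of "\<lambda>Q. avg Q f"] by (simp add: maximal_eq[abs_def])

lemma borel_measurable_sharp_maximal: "sharp_maximal f \<in> borel_measurable borel"
  using borel_Sup_cubes by (simp add: sharp_maximal_def[abs_def])

lemma AE_cong_avg:
  assumes "AE x in lebesgue. f x = g x" shows "avg Q f = avg Q g"
  unfolding avg_def using assms by (intro arg_cong2[where f="(/)"] nn_integral_cong_AE) auto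

lemma AE_cong_maximal:
  assumes "AE x in lebesgue. f x = g x" shows "maximal f x = maximal g x"
  using AE_cong_avg[OF assms] by (simp add: maximal_eq)

lemma norm_le_card_cart:
  fixes x :: "real ^ 'n"
  assumes "\<And>i. \<bar>x $ i\<bar> \<le> l" shows "norm x \<le> real CARD('n) * l"
proof -
  have "norm x \<le> (\<Sum>i\<in>UNIV. \<bar>x $ i\<bar>)" by (rule norm_le_l1_cart)
  also have "\<dots> \<le> (\<Sum>i\<in>(UNIV::'n set). l)" by (rule sum_mono) (use assms in auto)
  finally show ?thesis by simp
qed

lemma norm_diff_cube:
  fixes x y :: "real ^ 'n"
  assumes "x \<in> cube a l" "y \<in> cube a l" shows "norm (x - y) \<le> real CARD('n) * l"
proof (rule norm_le_card_cart)
  fix i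
  have "a $ i < x $ i \<and> x $ i < a $ i + l" "a $ i < y $ i \<and> y $ i < a $ i + l"
    using assms by (auto simp: mem_cube)
  then show "\<bar>(x - y) $ i\<bar> \<le> l" by (auto simp: abs_if)
qed

text \<open>Countable subadditivity for an arbitrary countable index set, moved to the naturals by
  \<open>to_nat_on\<close>. It serves for the dilated cubes of the Vitali selection, which may
  overlap.\<close>

lemma emeasure_UN_countable_le:
  assumes C: "countable C" and A: "\<And>k. k \<in> C \<Longrightarrow> A k \<in> sets M"
  shows "emeasure M (\<Union>k\<in>C. A k) \<le> (\<integral>\<^sup>+k. emeasure M (A k) \<partial>count_space C)"
proof -
  let ?I = "to_nat_on C ` C"
  define F where "F = (\<lambda>n. if n \<in> ?I then A (from_nat_into C n) else {})"
  have F: "F (to_nat_on C k) = A k" if "k \<in> C" for k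
    using that C by (simp add: F_def)
  have "(\<Union>k\<in>C. A k) \<subseteq> (\<Union>n. F n)" using F by blast
  moreover have "range F \<subseteq> sets M" using C A by (auto simp: F_def)
  ultimately have "emeasure M (\<Union>k\<in>C. A k) \<le> (\<Sum>n. emeasure M (F n))"
    by (intro order_trans[OF emeasure_mono emeasure_subadditive_countably]) auto
  also have "\<dots> = (\<integral>\<^sup>+n. emeasure M (F n) \<partial>count_space ?I)"
    unfolding nn_integral_count_space_nat[symmetric]
    by (subst (2) nn_integral_count_space_indicator)
      (auto intro!: nn_integral_cong simp: F_def indicator_def)
  also have "\<dots> = (\<integral>\<^sup>+k. emeasure M (F (to_nat_on C k)) \<partial>count_space C)"
    using C by (intro nn_integral_bij_count_space[symmetric] inj_on_imp_bij_betw inj_on_to_nat_on)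
  also have "\<dots> = (\<integral>\<^sup>+k. emeasure M (A k) \<partial>count_space C)"
    by (intro nn_integral_cong) (simp add: F)
  finally show ?thesis .
qed

text \<open>Vitali's covering argument. A cube of side l lies in a ball of radius n l; the ball of
  five times this radius lies in a cube of side 10 n l, whose volume is (10 n)^n times that of the
  first cube.\<close>

lemma maximal_weak_type:
  fixes f :: "real ^ 'n \<Rightarrow> real"
  assumes f: "f \<in> borel_measurable lebesgue" and t: "0 < t"
  shows "emeasure lebesgue {x. ennreal t < maximal f x}
    \<le> ennreal ((10 * CARD('n)) ^ CARD('n) / t) * (\<integral>\<^sup>+x. ennreal \<bar>f x\<bar> \<partial>lebesgue)"
proof (cases "(\<integral>\<^sup>+x. ennreal \<bar>f x\<bar> \<partial>lebesgue)")
  case top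
  then show ?thesis using t by (simp add: ennreal_mult_top)
next
  case (real I)
  define n where "n = real CARD('n)"
  have n: "1 \<le> n" by (simp add: n_def Suc_le_eq)
  define K where "K = {(a :: real ^ 'n, l). 0 < l \<and> ennreal t < avg (cube a l) f}"
  define c where "c = (\<lambda>(a :: real ^ 'n, l). \<chi> i. a $ i + l / 2)"
  define r where "r = (\<lambda>(a :: real ^ 'n, l). n * l)"
  define q where "q = (\<lambda>(a :: real ^ 'n, l). cube a l)"
  have qI: "ennreal t * emeasure lebesgue (q k) \<le> (\<integral>\<^sup>+y\<in>q k. ennreal \<bar>f y\<bar> \<partial>lebesgue)" if "k \<in> K" for k
  proof -
    obtain a l where k: "k = (a, l)" by force
    then have "0 < l" "ennreal t < avg (q k) f" using that by (auto simp: K_def q_def)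
    moreover have "q k \<in> cubes" using \<open>0 < l\<close> k by (simp add: q_def cube_in_cubes)
    ultimately show ?thesis
      unfolding nn_integral_eq_avg[OF \<open>q k \<in> cubes\<close>] by (intro mult_right_mono) auto
  qed
  have lpos: "0 < snd k" if "k \<in> K" for k using that by (auto simp: K_def)
  have em_q: "emeasure lebesgue (q k) = ennreal (snd k ^ CARD('n))" if "k \<in> K" for k
    using emeasure_cube[of "snd k" "fst k"] lpos[OF that] by (simp add: q_def case_prod_unfold)
  have sets_q: "q k \<in> sets lebesgue" for k by (simp add: q_def cube_def case_prod_unfold)
  \<comment> \<open>The covering lemma asks for bounded radii. The average condition gives t l^n
    \<le> I, and l \<le> l^n as soon as l > 1.\<close>
  have lbd: "snd k \<le> max 1 (I / t)" if k: "k \<in> K" for k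
  proof -
    have "ennreal (t * snd k ^ CARD('n)) = ennreal t * emeasure lebesgue (q k)"
      using em_q[OF k] t lpos[OF k] by (simp add: ennreal_mult)
    also have "\<dots> \<le> (\<integral>\<^sup>+y\<in>q k. ennreal \<bar>f y\<bar> \<partial>lebesgue)" by (rule qI[OF k])
    also have "\<dots> \<le> (\<integral>\<^sup>+y. ennreal \<bar>f y\<bar> \<partial>lebesgue)"
      by (intro nn_integral_mono) (auto simp: indicator_def)
    also have "\<dots> = ennreal I" by (rule real)
    finally have "t * snd k ^ CARD('n) \<le> I" using real by simp
    then have 1: "snd k ^ CARD('n) \<le> I / t" using t by (simp add: field_simps)
    show ?thesis
    proof (cases "snd k \<le> 1")
      case False
      then have "snd k ^ 1 \<le> snd k ^ CARD('n)" by (intro power_increasing) (auto simp: Suc_le_eq)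
      then show ?thesis using 1 by simp
    qed simp
  qed
  have sub1: "q k \<subseteq> cball (c k) (r k)" for k
  proof
    fix x assume "x \<in> q k"
    then have x: "x \<in> cube (fst k) (snd k)" by (simp add: q_def case_prod_unfold)
    have "norm (c k - x) \<le> n * snd k" unfolding n_def
    proof (rule norm_le_card_cart)
      fix i show "\<bar>(c k - x) $ i\<bar> \<le> snd k"
        using x[unfolded mem_cube, rule_format, of i] by (auto simp: c_def case_prod_unfold abs_if)
    qed
    then show "x \<in> cball (c k) (r k)" by (simp add: dist_norm r_def case_prod_unfold)
  qed
  have rB: "\<And>k. k \<in> K \<Longrightarrow> 0 < r k \<and> r k \<le> n * max 1 (I / t)"
    using lpos lbd n by (auto simp: r_def case_prod_unfold intro!: mult_pos_pos mult_left_mono)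
  obtain C where C: "countable C" "C \<subseteq> K"
     "pairwise (\<lambda>i j. disjnt (cball (c i) (r i)) (cball (c j) (r j))) C"
     "\<And>i. i \<in> K \<Longrightarrow> \<exists>j. j \<in> C \<and> \<not> disjnt (cball (c i) (r i)) (cball (c j) (r j)) \<and>
        cball (c i) (r i) \<subseteq> ball (c j) (5 * r j)"
    by (rule Vitali_covering_lemma_cballs_balls[where a = c and r = r and K = K, OF rB]) (blast intro: that)+
  define q5 where "q5 = (\<lambda>k. cube (\<chi> i. c k $ i - 5 * r k) (10 * r k))"
  have sub5: "ball (c k) (5 * r k) \<subseteq> q5 k" for k
  proof
    fix x assume x: "x \<in> ball (c k) (5 * r k)"
    have "\<bar>(c k - x) $ i\<bar> < 5 * r k" for i
      using component_le_norm_cart[of "c k - x" i] x by (simp add: dist_norm)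
    then have "\<bar>c k $ i - x $ i\<bar> < 5 * r k" for i by (metis vector_minus_component)
    then have "c k $ i - 5 * r k < x $ i \<and> x $ i < c k $ i - 5 * r k + 10 * r k" for i
      unfolding abs_less_iff by (smt (verit))
    then show "x \<in> q5 k" by (simp add: q5_def mem_cube)
  qed
  have em_q5: "emeasure lebesgue (q5 k) = ennreal ((10 * n) ^ CARD('n)) * emeasure lebesgue (q k)" if "k \<in> K" for k
    using emeasure_cube[of "10 * r k"] em_q[OF that] lpos[OF that] n
    by (simp add: q5_def r_def case_prod_unfold power_mult_distrib ennreal_mult mult_ac)
  have "{x. ennreal t < maximal f x} \<subseteq> (\<Union>k\<in>C. q5 k)"
  proof
    fix x assume "x \<in> {x. ennreal t < maximal f x}"
    then obtain Q where "Q \<in> cubes" "x \<in> Q" "ennreal t < avg Q f"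
      by (auto simp: maximal_eq less_SUP_iff)
    then obtain a l where "(a, l) \<in> K" "x \<in> q (a, l)" by (auto simp: K_def q_def elim!: cubesE)
    then show "x \<in> (\<Union>k\<in>C. q5 k)" using C(4) sub1 sub5 by blast
  qed
  then have "emeasure lebesgue {x. ennreal t < maximal f x} \<le> emeasure lebesgue (\<Union>k\<in>C. q5 k)"
    by (intro emeasure_mono) (auto simp: q5_def cube_def intro!: sets.countable_UN'' C(1))
  also have "\<dots> \<le> (\<integral>\<^sup>+k. emeasure lebesgue (q5 k) \<partial>count_space C)"
    by (rule emeasure_UN_countable_le) (auto simp: q5_def cube_def C(1))
  also have "\<dots> = (\<integral>\<^sup>+k. ennreal ((10 * n) ^ CARD('n)) * emeasure lebesgue (q k) \<partial>count_space C)"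
    using C(2) by (intro nn_integral_cong) (auto simp: em_q5)
  also have "\<dots> \<le> (\<integral>\<^sup>+k. ennreal ((10 * n) ^ CARD('n) / t) * (\<integral>\<^sup>+y\<in>q k. ennreal \<bar>f y\<bar> \<partial>lebesgue) \<partial>count_space C)"
  proof (intro nn_integral_mono)
    fix k assume "k \<in> space (count_space C)"
    then have "k \<in> K" using C(2) by auto
    have "ennreal ((10 * n) ^ CARD('n)) * emeasure lebesgue (q k)
      = ennreal ((10 * n) ^ CARD('n) / t) * (ennreal t * emeasure lebesgue (q k))"
      using t n by (simp add: mult.assoc[symmetric] flip: ennreal_mult)
    also have "\<dots> \<le> ennreal ((10 * n) ^ CARD('n) / t) * (\<integral>\<^sup>+y\<in>q k. ennreal \<bar>f y\<bar> \<partial>lebesgue)"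
      by (intro mult_left_mono qI \<open>k \<in> K\<close>) simp
    finally show "ennreal ((10 * n) ^ CARD('n)) * emeasure lebesgue (q k) \<le>
        ennreal ((10 * n) ^ CARD('n) / t) * (\<integral>\<^sup>+y\<in>q k. ennreal \<bar>f y\<bar> \<partial>lebesgue)" .
  qed
  also have "\<dots> = ennreal ((10 * n) ^ CARD('n) / t) * (\<integral>\<^sup>+k. (\<integral>\<^sup>+y\<in>q k. ennreal \<bar>f y\<bar> \<partial>lebesgue) \<partial>count_space C)"
    by (rule nn_integral_cmult) simp
  \<comment> \<open>The selected balls are disjoint, hence so are the cubes inside them. With |f| as
    a density, the sum of the integrals is the measure of one union.\<close>
  also have "(\<integral>\<^sup>+k. (\<integral>\<^sup>+y\<in>q k. ennreal \<bar>f y\<bar> \<partial>lebesgue) \<partial>count_space C)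
      = (\<integral>\<^sup>+k. emeasure (density lebesgue (\<lambda>y. ennreal \<bar>f y\<bar>)) (q k) \<partial>count_space C)"
    using f sets_q by (intro nn_integral_cong) (simp add: emeasure_density)
  also have "\<dots> = emeasure (density lebesgue (\<lambda>y. ennreal \<bar>f y\<bar>)) (\<Union>k\<in>C. q k)"
  proof (rule emeasure_UN_countable[symmetric])
    show "disjoint_family_on q C"
      using C(3) sub1 unfolding disjoint_family_on_def pairwise_def disjnt_def by blast
  qed (use sets_q C(1) in auto)
  also have "\<dots> \<le> (\<integral>\<^sup>+y. ennreal \<bar>f y\<bar> \<partial>lebesgue)"
    using emeasure_space[of "density lebesgue (\<lambda>y. ennreal \<bar>f y\<bar>)" "\<Union>k\<in>C. q k"] f
    by (simp add: emeasure_density)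
  finally show ?thesis by (simp add: n_def mult_left_mono)
qed

section \<open>The strong type (2,2) estimate\<close>

lemma avg_triangle:
  assumes "Q \<in> cubes" and [measurable]: "g \<in> borel_measurable lebesgue" "h \<in> borel_measurable lebesgue"
    and le: "\<And>x. x \<in> Q \<Longrightarrow> \<bar>f x\<bar> \<le> \<bar>g x\<bar> + \<bar>h x\<bar>"
  shows "avg Q f \<le> avg Q g + avg Q h"
proof -
  have [measurable]: "Q \<in> sets lebesgue" using assms(1) by (rule sets_cubes)
  have "(\<integral>\<^sup>+y\<in>Q. ennreal \<bar>f y\<bar> \<partial>lebesgue) \<le> (\<integral>\<^sup>+y. ennreal \<bar>g y\<bar> * indicator Q y + ennreal \<bar>h y\<bar> * indicator Q y \<partial>lebesgue)"
    using le by (intro nn_integral_mono) (auto simp: indicator_def simp flip: ennreal_plus)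
  also have "\<dots> = (\<integral>\<^sup>+y\<in>Q. ennreal \<bar>g y\<bar> \<partial>lebesgue) + (\<integral>\<^sup>+y\<in>Q. ennreal \<bar>h y\<bar> \<partial>lebesgue)"
    by (intro nn_integral_add) auto
  finally show ?thesis
    unfolding avg_def add_divide_distrib_ennreal[symmetric] by (intro divide_right_mono_ennreal)
qed

lemma avg_mono: "(\<And>x. x \<in> Q \<Longrightarrow> \<bar>f x\<bar> \<le> \<bar>g x\<bar>) \<Longrightarrow> avg Q f \<le> avg Q g"
  unfolding avg_def
  by (intro divide_right_mono_ennreal nn_integral_mono) (auto simp: indicator_def ennreal_leI)

lemma avg_cmult:
  assumes "Q \<in> cubes" and [measurable]: "f \<in> borel_measurable lebesgue"
  shows "avg Q (\<lambda>x. c * f x) = ennreal \<bar>c\<bar> * avg Q f"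
proof -
  have [measurable]: "Q \<in> sets lebesgue" using assms(1) by (rule sets_cubes)
  have "(\<integral>\<^sup>+y\<in>Q. ennreal \<bar>c * f y\<bar> \<partial>lebesgue) = (\<integral>\<^sup>+y. ennreal \<bar>c\<bar> * (ennreal \<bar>f y\<bar> * indicator Q y) \<partial>lebesgue)"
    by (intro nn_integral_cong) (auto simp: indicator_def abs_mult ennreal_mult)
  also have "\<dots> = ennreal \<bar>c\<bar> * (\<integral>\<^sup>+y\<in>Q. ennreal \<bar>f y\<bar> \<partial>lebesgue)"
    by (intro nn_integral_cmult) auto
  finally show ?thesis by (simp add: avg_def ennreal_times_divide)
qed

lemma avg_const: assumes "Q \<in> cubes" shows "avg Q (\<lambda>_. c) = ennreal \<bar>c\<bar>"
  using emeasure_cubes_pos[OF assms] emeasure_cubes_finite[OF assms] sets_cubes[OF assms]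
  by (simp add: avg_def nn_integral_cmult_indicator ennreal_mult_divide_eq)

section \<open>Layer cake formula and interpolation\<close>

lemma nn_integral_2t: "0 \<le> a \<Longrightarrow> (\<integral>\<^sup>+t\<in>{0<..<a}. ennreal (2 * t) \<partial>lborel) = ennreal (a\<^sup>2)"
proof -
  assume a: "0 \<le> a"
  have "(\<integral>\<^sup>+t\<in>{0<..<a}. ennreal (2 * t) \<partial>lborel) = (\<integral>\<^sup>+t. ennreal (2 * t) * indicator {0..a} t \<partial>lborel)"
  proof (rule nn_integral_cong_AE)
    show "AE t in lborel. ennreal (2 * t) * indicator {0<..<a} t = ennreal (2 * t) * indicator {0..a} t"
      using AE_lborel_singleton[of 0] AE_lborel_singleton[of a]
      by eventually_elim (auto simp: indicator_def)
  qed
  also have "\<dots> = ennreal (a\<^sup>2 - 0\<^sup>2)"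
    using a by (intro nn_integral_FTC_Icc) (auto intro!: derivative_eq_intros)
  finally show ?thesis by simp
qed

text \<open>Since a^2 is the integral of 2 t over 0 < t < a, the bound holds for every real a below
  y. If y is \<infinity>, the choice a = sqrt N makes the right side exceed every N.\<close>

lemma ennreal_sq_le_layers:
  "(y :: ennreal)\<^sup>2 \<le> (\<integral>\<^sup>+t. (if 0 < t \<and> ennreal t < y then ennreal (2 * t) else 0) \<partial>lborel)"
proof -
  have *: "ennreal (a\<^sup>2) \<le> (\<integral>\<^sup>+t. (if 0 < t \<and> ennreal t < y then ennreal (2 * t) else 0) \<partial>lborel)"
    if "0 \<le> a" "ennreal a \<le> y" for a
  proof -
    have "ennreal t < y" if "0 < t" "t < a" for t
      using \<open>ennreal a \<le> y\<close> that by (metis ennreal_lessI less_le_trans less_trans)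
    then show ?thesis unfolding nn_integral_2t[OF \<open>0 \<le> a\<close>, symmetric]
      by (intro nn_integral_mono) (auto simp: indicator_def)
  qed
  show ?thesis
  proof (cases y)
    case (real a)
    then show ?thesis using *[of a] by (simp add: ennreal_power)
  next
    case top
    have "of_nat N \<le> (\<integral>\<^sup>+t. (if 0 < t \<and> ennreal t < y then ennreal (2 * t) else 0) \<partial>lborel)" for N
      using *[of "sqrt (real N)"] top by (simp add: ennreal_of_nat_eq_real_of_nat)
    then have "(\<integral>\<^sup>+t. (if 0 < t \<and> ennreal t < y then ennreal (2 * t) else 0) \<partial>lborel) = \<infinity>"
      by (metis ennreal_Ex_less_of_nat infinity_ennreal_def leD less_top)
    then show ?thesis by simp
  qed
qed

text \<open>The part of f with |f| \<le> t/2 adds at most t/2 to any average, so at least half of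
  the level t must come from the large values.\<close>

lemma maximal_truncate:
  assumes [measurable]: "f \<in> borel_measurable lebesgue" and t: "0 < t" and less: "ennreal t < maximal f x"
  shows "ennreal (t / 2) < maximal (\<lambda>y. if t < 2 * \<bar>f y\<bar> then f y else 0) x"
proof -
  obtain Q where Q: "Q \<in> cubes" "x \<in> Q" "ennreal t < avg Q f"
    using less by (auto simp: maximal_eq less_SUP_iff)
  let ?g = "\<lambda>y. if t < 2 * \<bar>f y\<bar> then f y else 0"
  have "avg Q f \<le> avg Q ?g + avg Q (\<lambda>_. t / 2)"
    using t by (intro avg_triangle Q) auto
  then have "ennreal (t / 2) + ennreal (t / 2) < avg Q ?g + ennreal (t / 2)"
    using Q t by (simp add: avg_const flip: ennreal_plus)
  then have "ennreal (t / 2) < avg Q ?g" using add_right_mono[of "avg Q ?g" "ennreal (t / 2)" "ennreal (t / 2)"] by (auto simp: not_le[symmetric])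
  then show ?thesis using avg_le_maximal[OF Q(1,2), of ?g] by simp
qed

text \<open>Marcinkiewicz interpolation between the weak type estimate and the trivial bound for
  bounded functions. Borel functions and \<open>lborel\<close> provide the joint measurability in x
  and t for exchanging the integrals.\<close>

lemma maximal_L2_borel:
  fixes f :: "real ^ 'n \<Rightarrow> real"
  assumes f [measurable]: "f \<in> borel_measurable borel"
  shows "(\<integral>\<^sup>+x. (maximal f x)\<^sup>2 \<partial>lborel) \<le> ennreal (8 * (10 * CARD('n)) ^ CARD('n)) * (\<integral>\<^sup>+x. ennreal ((f x)\<^sup>2) \<partial>lborel)"
proof -
  define D where "D = real ((10 * CARD('n)) ^ CARD('n))"
  have D: "0 \<le> D" by (simp add: D_def)
  note borel_measurable_maximal[measurable]
  interpret lborel_pair: pair_sigma_finite "lborel :: real measure" "lborel :: (real^'n) measure" ..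
  have "(\<integral>\<^sup>+x. (maximal f x)\<^sup>2 \<partial>lborel) \<le>
    (\<integral>\<^sup>+x. (\<integral>\<^sup>+t. (if 0 < t \<and> ennreal t < maximal f x then ennreal (2 * t) else 0) \<partial>lborel) \<partial>lborel)"
    by (intro nn_integral_mono ennreal_sq_le_layers)
  also have "\<dots> = (\<integral>\<^sup>+t. (\<integral>\<^sup>+x. (if 0 < t \<and> ennreal t < maximal f x then ennreal (2 * t) else 0) \<partial>lborel) \<partial>lborel)"
    by (intro lborel_pair.Fubini') measurable
  also have "\<dots> \<le> (\<integral>\<^sup>+t. (\<integral>\<^sup>+x. (if 0 < t \<and> t < 2 * \<bar>f x\<bar> then ennreal (4 * D * \<bar>f x\<bar>) else 0) \<partial>lborel) \<partial>lborel)"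
  proof (rule nn_integral_mono)
    fix t :: real
    show "(\<integral>\<^sup>+x. (if 0 < t \<and> ennreal t < maximal f x then ennreal (2 * t) else 0) \<partial>lborel)
      \<le> (\<integral>\<^sup>+x. (if 0 < t \<and> t < 2 * \<bar>f x\<bar> then ennreal (4 * D * \<bar>f x\<bar>) else 0) \<partial>lborel)"
    proof (cases "0 < t")
      case True
      let ?g = "\<lambda>y. if t < 2 * \<bar>f y\<bar> then f y else 0"
      have m: "f \<in> borel_measurable lebesgue" "?g \<in> borel_measurable lebesgue"
        by (auto intro!: measurable_completion)
      have "(\<integral>\<^sup>+x. (if 0 < t \<and> ennreal t < maximal f x then ennreal (2 * t) else 0) \<partial>lborel)
        \<le> (\<integral>\<^sup>+x. ennreal (2 * t) * indicator {x. ennreal (t/2) < maximal ?g x} x \<partial>lborel)"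
        using maximal_truncate[OF m(1) True] by (intro nn_integral_mono) (auto simp: indicator_def)
      also have "\<dots> = ennreal (2 * t) * emeasure lebesgue {x. ennreal (t/2) < maximal ?g x}"
        by (subst nn_integral_cmult_indicator) auto
      \<comment> \<open>Truncation costs half of the level, so the weak type estimate enters at t/2;
        the product of 2 t and D / (t/2) is 4 D, independent of t.\<close>
      also have "\<dots> \<le> ennreal (2 * t) * (ennreal (D / (t/2)) * (\<integral>\<^sup>+x. ennreal \<bar>?g x\<bar> \<partial>lebesgue))"
        using maximal_weak_type[OF m(2), of "t/2"] True by (intro mult_left_mono) (auto simp: D_def)
      also have "\<dots> = ennreal (4 * D) * (\<integral>\<^sup>+x. ennreal \<bar>?g x\<bar> \<partial>lborel)"
        using True D by (simp add: mult.assoc[symmetric] nn_integral_completion flip: ennreal_mult)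
      also have "\<dots> = (\<integral>\<^sup>+x. ennreal (4 * D) * ennreal \<bar>?g x\<bar> \<partial>lborel)"
        by (rule nn_integral_cmult[symmetric]) measurable
      also have "\<dots> = (\<integral>\<^sup>+x. (if 0 < t \<and> t < 2 * \<bar>f x\<bar> then ennreal (4 * D * \<bar>f x\<bar>) else 0) \<partial>lborel)"
        using True D by (intro nn_integral_cong) (auto simp: ennreal_mult)
      finally show ?thesis .
    qed simp
  qed
  also have "\<dots> = (\<integral>\<^sup>+x. (\<integral>\<^sup>+t. (if 0 < t \<and> t < 2 * \<bar>f x\<bar> then ennreal (4 * D * \<bar>f x\<bar>) else 0) \<partial>lborel) \<partial>lborel)"
    by (intro lborel_pair.Fubini'[symmetric]) measurable
  \<comment> \<open>For fixed x the integrand in t is constant on 0 < t < 2 |f x|, an interval of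
    length 2 |f x|.\<close>
  also have "\<dots> = (\<integral>\<^sup>+x. ennreal (8 * D) * ennreal ((f x)\<^sup>2) \<partial>lborel)"
  proof (intro nn_integral_cong)
    fix x
    have "(\<integral>\<^sup>+t. (if 0 < t \<and> t < 2 * \<bar>f x\<bar> then ennreal (4 * D * \<bar>f x\<bar>) else 0) \<partial>lborel)
      = (\<integral>\<^sup>+t. ennreal (4 * D * \<bar>f x\<bar>) * indicator {0<..<2 * \<bar>f x\<bar>} t \<partial>lborel)"
      by (intro nn_integral_cong) (auto simp: indicator_def)
    also have "\<dots> = ennreal (4 * D * \<bar>f x\<bar>) * ennreal (2 * \<bar>f x\<bar>)"
      by (subst nn_integral_cmult_indicator) auto
    also have "\<dots> = ennreal (8 * D) * ennreal ((f x)\<^sup>2)"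
      using D by (simp add: power2_eq_square abs_mult_self_eq mult_ac flip: ennreal_mult)
    finally show "(\<integral>\<^sup>+t. (if 0 < t \<and> t < 2 * \<bar>f x\<bar> then ennreal (4 * D * \<bar>f x\<bar>) else 0) \<partial>lborel)
      = ennreal (8 * D) * ennreal ((f x)\<^sup>2)" .
  qed
  also have "\<dots> = ennreal (8 * D) * (\<integral>\<^sup>+x. ennreal ((f x)\<^sup>2) \<partial>lborel)"
    by (rule nn_integral_cmult) measurable
  finally show ?thesis by (simp add: D_def)
qed

text \<open>A Lebesgue measurable function agrees a.e. with a Borel function, and averages do not
  see the difference, so the two maximal functions coincide everywhere.\<close>

lemma maximal_L2:
  fixes f :: "real ^ 'n \<Rightarrow> real"
  assumes "f \<in> borel_measurable lebesgue"
  shows "(\<integral>\<^sup>+x. (maximal f x)\<^sup>2 \<partial>lebesgue) \<le> ennreal (8 * (10 * CARD('n)) ^ CARD('n)) * (\<integral>\<^sup>+x. ennreal ((f x)\<^sup>2) \<partial>lebesgue)"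
proof -
  obtain g where g: "g \<in> borel_measurable lborel" "AE x in lborel. f x = g x"
    using completion_ex_borel_measurable_real[OF assms] by auto
  have fg: "AE x in lebesgue. f x = g x" using g(2) by (rule AE_completion)
  have "maximal f = maximal g" using AE_cong_maximal[OF fg] by auto
  moreover have "(\<integral>\<^sup>+x. ennreal ((f x)\<^sup>2) \<partial>lebesgue) = (\<integral>\<^sup>+x. ennreal ((g x)\<^sup>2) \<partial>lebesgue)"
    using fg by (intro nn_integral_cong_AE) auto
  ultimately show ?thesis using maximal_L2_borel[of g] g(1) by (simp add: nn_integral_completion)
qed

text \<open>Small cubes see only a bounded, hence integrable, part of the function.\<close>

section \<open>Modulars and norms\<close>

lemma maximal_finite_AE:
  fixes f :: "real ^ 'n \<Rightarrow> real"
  assumes f: "f \<in> borel_measurable lebesgue" and fin: "(\<integral>\<^sup>+x. ennreal \<bar>f x\<bar> \<partial>lebesgue) < \<infinity>"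
  shows "AE x in lebesgue. maximal f x < \<infinity>"
proof -
  note borel_measurable_maximal[measurable]
  obtain I where I: "(\<integral>\<^sup>+x. ennreal \<bar>f x\<bar> \<partial>lebesgue) = ennreal I" "0 \<le> I"
    using fin by (cases "\<integral>\<^sup>+x. ennreal \<bar>f x\<bar> \<partial>lebesgue") auto
  define D where "D = real ((10 * CARD('n)) ^ CARD('n))"
  have D: "0 \<le> D" by (simp add: D_def)
  have S: "{x. maximal f x = \<infinity>} \<in> sets lebesgue"
    by (rule sets_completionI_sets) measurable
  \<comment> \<open>The set where the maximal function is infinite lies in every superlevel set; the
    weak type bounds for these tend to 0.\<close>
  have "emeasure lebesgue {x. maximal f x = \<infinity>} \<le> ennreal (D * I / real (Suc k))" for k
  proof -
    have "emeasure lebesgue {x. maximal f x = \<infinity>} \<le> emeasure lebesgue {x. ennreal (Suc k) < maximal f x}"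
      by (intro emeasure_mono sets_completionI_sets) (auto, measurable)
    also have "\<dots> \<le> ennreal (D / real (Suc k)) * ennreal I"
      using maximal_weak_type[OF f, of "Suc k"] by (simp add: I D_def del: of_nat_Suc)
    also have "\<dots> = ennreal (D * I / real (Suc k))"
      using D I by (simp flip: ennreal_mult)
    finally show ?thesis .
  qed
  moreover have "(\<lambda>k. ennreal (D * I / real (Suc k))) \<longlonglongrightarrow> ennreal 0"
    by (intro tendsto_ennrealI) (rule LIMSEQ_Suc[OF lim_const_over_n])
  ultimately have "emeasure lebesgue {x. maximal f x = \<infinity>} \<le> ennreal 0"
    by (intro LIMSEQ_le_const) auto
  then have "{x. maximal f x = \<infinity>} \<in> null_sets lebesgue" using S by auto
  then show ?thesis by (rule AE_I') (auto simp: not_less top_unique)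
qed

lemma cube_side_le:
  assumes "0 < l" "measure lebesgue (cube a l :: (real^'n) set) \<le> 1" shows "l \<le> 1"
proof (rule ccontr)
  assume "\<not> l \<le> 1"
  then have "1 < l ^ CARD('n)" by (simp add: one_less_power)
  then show False using assms by (simp add: measure_cube)
qed

text \<open>A cube of volume at most 1 has side at most 1, so through x it stays within distance n
  of x. Cutting f off at radius N + n with |x| \<le> N thus changes none of these averages.
  Countably many cutoffs share one null set, while B depends on x.\<close>

lemma small_cubes_bounded_AE:
  fixes f :: "real ^ 'n \<Rightarrow> real"
  assumes f: "locally_integrable f"
  shows "AE x in lebesgue. \<exists>B. \<forall>Q\<in>cubes. x \<in> Q \<longrightarrow> measure lebesgue Q \<le> 1 \<longrightarrow> avg Q f \<le> ennreal B"
proof -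
  define F where "F = (\<lambda>(N::nat) x. f x * indicator (cball 0 (real N + CARD('n))) x)"
  have int: "integrable lebesgue (F N)" for N
    using f compact_cball[of 0 "real N + CARD('n)"]
    unfolding locally_integrable_def set_integrable_def F_def by (force simp: mult.commute)
  have "AE x in lebesgue. maximal (F N) x < \<infinity>" for N
    using int[of N] by (intro maximal_finite_AE) (auto simp: integrable_iff_bounded)
  then have "AE x in lebesgue. \<forall>N. maximal (F N) x < \<infinity>" by (simp add: AE_all_countable)
  then show ?thesis
  proof eventually_elim
    fix x :: "real^'n" assume fin: "\<forall>N. maximal (F N) x < \<infinity>"
    define N where "N = nat \<lceil>norm x\<rceil>"
    have N: "norm x \<le> real N" by (simp add: N_def)
    have "avg Q f \<le> maximal (F N) x" if Q: "Q \<in> cubes" "x \<in> Q" "measure lebesgue Q \<le> 1" for Q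
    proof -
      obtain a l where al: "0 < l" "Q = cube a l" using Q(1) by (rule cubesE)
      then have "l \<le> 1" using Q(3) cube_side_le by blast
      have "Q \<subseteq> cball 0 (real N + CARD('n))"
      proof
        fix y assume "y \<in> Q"
        then have "norm (y - x) \<le> real CARD('n) * l" using Q(2) al(2) norm_diff_cube by auto
        also have "\<dots> \<le> real CARD('n) * 1" using \<open>l \<le> 1\<close> by (intro mult_left_mono) auto
        finally show "y \<in> cball 0 (real N + CARD('n))"
          using N norm_triangle_sub[of y x] by simp
      qed
      then have "avg Q f \<le> avg Q (F N)" by (intro avg_mono) (auto simp: F_def)
      also have "\<dots> \<le> maximal (F N) x" using Q by (intro avg_le_maximal)
      finally show ?thesis .
    qed
    moreover obtain B where "maximal (F N) x = ennreal B" using fin[rule_format, of N] by (cases "maximal (F N) x") auto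
    ultimately show "\<exists>B. \<forall>Q\<in>cubes. x \<in> Q \<longrightarrow> measure lebesgue Q \<le> 1 \<longrightarrow> avg Q f \<le> ennreal B" by auto
  qed
qed

section \<open>Modulars, norms and boundedness in terms of modulars\<close>

lemma modular_measurable:
  assumes "variable_exponent p" "f \<in> borel_measurable lebesgue"
  shows "(\<lambda>x. ennreal ((\<bar>f x\<bar> / r) powr p x)) \<in> borel_measurable lebesgue"
proof -
  have [measurable]: "p \<in> borel_measurable lebesgue" "f \<in> borel_measurable lebesgue"
    using assms by (auto simp: variable_exponent_def)
  show ?thesis by measurable
qed

text \<open>Exponents are at least 1, so (1/c)^p \<le> 1/c. This is what turns a finite modular into
  one that is at most 1.\<close>

lemma modular_scale:
  assumes p: "variable_exponent p" and f: "f \<in> borel_measurable lebesgue" and "0 < r" "1 \<le> c"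
  shows "modular p f (c * r) \<le> ennreal (1 / c) * modular p f r"
proof -
  have "ennreal ((\<bar>f x\<bar> / (c * r)) powr p x) \<le> ennreal (1 / c) * ennreal ((\<bar>f x\<bar> / r) powr p x)" for x
  proof -
    have "1 \<le> p x" using p by (simp add: variable_exponent_def)
    have "(1 / c) powr p x \<le> (1 / c) powr 1"
      using \<open>1 \<le> c\<close> \<open>1 \<le> p x\<close> by (intro powr_mono') auto
    then have "(1 / c) powr p x * (\<bar>f x\<bar> / r) powr p x \<le> (1 / c) * (\<bar>f x\<bar> / r) powr p x"
      using \<open>1 \<le> c\<close> by (intro mult_right_mono) auto
    moreover have "(\<bar>f x\<bar> / (c * r)) powr p x = (1 / c) powr p x * (\<bar>f x\<bar> / r) powr p x"
      using assms by (subst powr_mult[symmetric]) auto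
    ultimately show ?thesis using \<open>1 \<le> c\<close> by (simp add: ennreal_leI flip: ennreal_mult)
  qed
  then have "modular p f (c * r) \<le> (\<integral>\<^sup>+x. ennreal (1 / c) * ennreal ((\<bar>f x\<bar> / r) powr p x) \<partial>lebesgue)"
    unfolding modular_def by (intro nn_integral_mono)
  also have "\<dots> = ennreal (1 / c) * modular p f r"
    unfolding modular_def by (intro nn_integral_cmult modular_measurable p f)
  finally show ?thesis .
qed

lemma modular_mono_AE:
  assumes "AE x in lebesgue. \<bar>f x\<bar> / r \<le> \<bar>g x\<bar> / s" "0 < r" "variable_exponent p"
  shows "modular p f r \<le> modular p g s"
  unfolding modular_def
proof (rule nn_integral_mono_AE, use assms(1) in eventually_elim)
  case (elim x)
  moreover have "1 \<le> p x" using assms(3) by (simp add: variable_exponent_def)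
  ultimately show ?case using assms(2) by (intro ennreal_leI powr_mono2) auto
qed

lemma modular_antimono:
  assumes "variable_exponent p" "0 < r" "r \<le> s"
  shows "modular p f s \<le> modular p f r"
  using assms by (intro modular_mono_AE) (auto intro!: divide_left_mono)

lemma var_Lp_modular_le_1:
  assumes p: "variable_exponent p" and f: "f \<in> var_Lp p"
  shows "\<exists>r>0. modular p f r \<le> 1"
proof -
  obtain r where r: "0 < r" "modular p f r < \<infinity>" using f by (auto simp: var_Lp_def)
  then obtain m where m: "modular p f r = ennreal m" "0 \<le> m" by (cases "modular p f r") auto
  have "modular p f (max 1 m * r) \<le> ennreal (1 / max 1 m) * ennreal m"
    using modular_scale[OF p _ r(1), of f "max 1 m"] f m by (simp add: var_Lp_def)
  also have "\<dots> = ennreal (m / max 1 m)" using m by (simp flip: ennreal_mult)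
  also have "\<dots> \<le> 1" using m by (simp add: divide_le_eq)
  finally show ?thesis using r(1) by (intro exI[of _ "max 1 m * r"]) auto
qed

lemma var_LpI:
  assumes "f \<in> borel_measurable lebesgue" "0 < r" "modular p f r \<le> 1"
  shows "f \<in> var_Lp p"
  using assms le_less_trans[of "modular p f r" 1 \<infinity>] by (auto simp: var_Lp_def)

lemma var_norm_le:
  assumes "f \<in> borel_measurable lebesgue" "0 < r" "modular p f r \<le> 1"
  shows "var_norm p f \<le> ennreal r"
  using var_LpI[OF assms] assms by (auto simp: var_norm_def intro!: Inf_lower)

text \<open>The strict inequality yields an admissible scale below r, so it does not matter whether
  the infimum in the norm is attained.\<close>

lemma modular_le_1I:
  assumes p: "variable_exponent p" and lt: "var_norm p f < ennreal r"
  shows "f \<in> var_Lp p" "modular p f r \<le> 1"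
proof -
  show f: "f \<in> var_Lp p" using lt by (auto simp: var_norm_def split: if_splits)
  then obtain s where s: "0 < s" "modular p f s \<le> 1" "ennreal s < ennreal r"
    using lt by (auto simp: var_norm_def Inf_less_iff)
  then show "modular p f r \<le> 1"
    using modular_antimono[OF p, of s r f] by (auto simp: ennreal_less_iff)
qed

text \<open>Boundedness may be checked on the modular: an estimate for every admissible scale s
  passes to the infimum, after moving C to the other side as a divisor.\<close>

lemma bounded_operatorI:
  assumes p: "variable_exponent p" and C: "0 < C"
    and T: "\<And>f s. f \<in> borel_measurable lebesgue \<Longrightarrow> 0 < s \<Longrightarrow> modular p f s \<le> 1 \<Longrightarrow>
      finite_ae (T f) \<and> (\<lambda>x. real_of_ereal (T f x)) \<in> borel_measurable lebesgue \<and>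
      modular q (\<lambda>x. real_of_ereal (T f x)) (C * s) \<le> 1"
  shows "bounded_operator T p q"
  unfolding bounded_operator_def
proof (intro exI[of _ C] ballI conjI)
  fix f assume f: "f \<in> var_Lp p"
  then have fm: "f \<in> borel_measurable lebesgue" by (simp add: var_Lp_def)
  show fin: "finite_ae (T f)" using var_Lp_modular_le_1[OF p f] T[OF fm] by auto
  have "var_norm_ereal q (T f) / ennreal C \<le> ennreal r" if "0 < r" "modular p f r \<le> 1" for r
  proof (rule divide_le_posI_ennreal)
    have "var_norm q (\<lambda>x. real_of_ereal (T f x)) \<le> ennreal (C * r)"
      using T[OF fm that] C that by (intro var_norm_le) auto
    then show "var_norm_ereal q (T f) \<le> ennreal C * ennreal r"
      using fin C that by (simp add: var_norm_ereal_def ennreal_mult)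
  qed (use C in simp)
  then have "var_norm_ereal q (T f) / ennreal C \<le> var_norm p f"
    using f by (auto simp: var_norm_def intro!: Inf_greatest)
  then have "ennreal C * (var_norm_ereal q (T f) / ennreal C) \<le> ennreal C * var_norm p f"
    by (intro mult_left_mono) auto
  then show "var_norm_ereal q (T f) \<le> ennreal C * var_norm p f"
    using C
    by (simp add: ennreal_times_divide mult.commute[of "ennreal C" "var_norm_ereal q (T f)"] mult_divide_eq_ennreal)
qed

lemma bounded_operatorD:
  assumes q: "variable_exponent q" and T: "bounded_operator T p q"
  shows "\<exists>C>0. \<forall>f s. f \<in> borel_measurable lebesgue \<longrightarrow> 0 < s \<longrightarrow> modular p f s \<le> 1 \<longrightarrow>
      finite_ae (T f) \<and> (\<lambda>x. real_of_ereal (T f x)) \<in> borel_measurable lebesgue \<and>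
      modular q (\<lambda>x. real_of_ereal (T f x)) (C * s) \<le> 1"
proof -
  obtain C where C: "\<And>f. f \<in> var_Lp p \<Longrightarrow> finite_ae (T f) \<and> var_norm_ereal q (T f) \<le> ennreal C * var_norm p f"
    using T by (auto simp: bounded_operator_def)
  show ?thesis
  \<comment> \<open>The constant in \<open>bounded_operator\<close> may be negative, in which case
    \<open>ennreal C\<close> is 0. Adding 1 makes the norm strictly smaller than the new scale, as
    \<open>modular_le_1I\<close> demands.\<close>
  proof (intro exI[of _ "max 0 C + 1"] conjI[OF _ allI[OF allI]] impI)
    show "0 < max 0 C + 1" by simp
    fix f and s :: real assume f: "f \<in> borel_measurable lebesgue" "0 < s" "modular p f s \<le> 1"
    note fL = var_LpI[OF f] and fn = var_norm_le[OF f]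
    have "var_norm q (\<lambda>x. real_of_ereal (T f x)) \<le> ennreal C * var_norm p f"
      using C[OF fL] unfolding var_norm_ereal_def by (simp split: if_splits)
    also have "\<dots> \<le> ennreal (max 0 C) * ennreal s" using fn by (intro mult_mono) (auto simp: ennreal_leI)
    also have "\<dots> = ennreal (max 0 C * s)" using f by (simp flip: ennreal_mult)
    also have "\<dots> < ennreal ((max 0 C + 1) * s)" using f by (intro ennreal_lessI mult_pos_pos mult_strict_right_mono) auto
    finally have *: "var_norm q (\<lambda>x. real_of_ereal (T f x)) < ennreal ((max 0 C + 1) * s)" .
    show "finite_ae (T f) \<and> (\<lambda>x. real_of_ereal (T f x)) \<in> borel_measurable lebesgue \<and>
      modular q (\<lambda>x. real_of_ereal (T f x)) ((max 0 C + 1) * s) \<le> 1"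
      using modular_le_1I[OF q *] C[OF fL] by (simp add: var_Lp_def)
  qed
qed

text \<open>Hoelder's inequality for averages in normalized form: Young's inequality for u/U and v/V
  is linear in u and v, and after averaging the weights \<theta> and 1 - \<theta> add up to
  1.\<close>

lemma avg_Holder:
  assumes Q: "Q \<in> cubes" and [measurable]: "u \<in> borel_measurable lebesgue" "v \<in> borel_measurable lebesgue"
    and nn: "\<And>x. 0 \<le> u x" "\<And>x. 0 \<le> v x" and th: "0 < \<theta>" "\<theta> < 1"
    and U: "0 < U" "avg Q u \<le> ennreal U" and V: "0 < V" "avg Q v \<le> ennreal V"
  shows "avg Q (\<lambda>x. u x powr \<theta> * v x powr (1 - \<theta>)) \<le> ennreal (U powr \<theta> * V powr (1 - \<theta>))"
proof -
  define W where "W = U powr \<theta> * V powr (1 - \<theta>)"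
  have W: "0 < W" using U V by (simp add: W_def)
  have "u x powr \<theta> * v x powr (1 - \<theta>) \<le> W * \<theta> / U * u x + W * (1 - \<theta>) / V * v x" for x
  proof (cases "u x = 0 \<or> v x = 0")
    case True
    then show ?thesis using W U V th nn by (auto intro!: add_nonneg_nonneg)
  next
    case False
    then have pos: "0 < u x" "0 < v x" using nn[of x] by auto
    have "u x powr \<theta> * v x powr (1 - \<theta>) = W * ((u x / U) powr \<theta> * (v x / V) powr (1 - \<theta>))"
      using pos U V by (simp add: powr_divide W_def)
    also have "\<dots> \<le> W * (\<theta> * (u x / U) + (1 - \<theta>) * (v x / V))"
      using pos U V W th by (intro mult_left_mono Youngs_inequality_0) auto
    finally show ?thesis by (simp add: algebra_simps)
  qed
  then have "avg Q (\<lambda>x. u x powr \<theta> * v x powr (1 - \<theta>))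
    \<le> avg Q (\<lambda>x. W * \<theta> / U * u x) + avg Q (\<lambda>x. W * (1 - \<theta>) / V * v x)"
    using W U V th nn by (intro avg_triangle Q) (auto simp: abs_mult)
  also have "\<dots> = ennreal (W * \<theta> / U) * avg Q u + ennreal (W * (1 - \<theta>) / V) * avg Q v"
    using W U V th by (subst (1 2) avg_cmult[OF Q]) auto
  also have "\<dots> \<le> ennreal (W * \<theta> / U) * ennreal U + ennreal (W * (1 - \<theta>) / V) * ennreal V"
    by (intro add_mono mult_left_mono U V) auto
  also have "\<dots> = ennreal (W * \<theta> + W * (1 - \<theta>))"
    using W U V th by (simp flip: ennreal_mult ennreal_plus)
  also have "W * \<theta> + W * (1 - \<theta>) = W" by (simp add: algebra_simps)
  finally show ?thesis by (simp add: W_def)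
qed

text \<open>\<open>avg_Holder\<close> asks for positive bounds, but the majorant of a maximal
  function may vanish at a point. The bound is therefore proved for all W above it and W is lowered
  to V.\<close>

lemma ennreal_le_powr_limit:
  assumes "0 \<le> V" "0 < a" and le: "\<And>W. V < W \<Longrightarrow> X \<le> ennreal (W powr a)"
  shows "X \<le> ennreal (V powr a)"
proof -
  have "(\<lambda>k. V + 1 / real (Suc k)) \<longlonglongrightarrow> V + 0"
    by (intro tendsto_add tendsto_const LIMSEQ_Suc[OF lim_const_over_n])
  then have "(\<lambda>k. ennreal ((V + 1 / real (Suc k)) powr a)) \<longlonglongrightarrow> ennreal (V powr a)"
    using assms by (intro tendsto_ennrealI tendsto_powr') auto
  then show ?thesis by (rule LIMSEQ_le_const) (auto intro!: le)
qed

section \<open>Maximal operators on variable exponent spaces\<close>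

lemma exponent_pairsD:
  fixes p q :: "real ^ 'n \<Rightarrow> real"
  assumes "(p, q) \<in> exponent_pairs \<beta>" and "\<beta> < 1"
  defines "\<theta> \<equiv> \<beta> / CARD('n)"
  shows "0 < \<theta>" "\<theta> < 1" "variable_exponent p" "variable_exponent q"
    "AE x in lebesgue. 1 / q x = 1 / p x - \<theta>" "(\<lambda>x. q x * (1 - \<theta>)) \<in> exponents_B"
proof -
  have n: "1 \<le> real CARD('n)" by (simp add: Suc_le_eq)
  show "0 < \<theta>" using assms by (simp add: exponent_pairs_def)
  have "\<beta> < real CARD('n)" using assms(2) n by linarith
  then show "\<theta> < 1" by (simp add: \<theta>_def divide_less_eq)
  show "variable_exponent p" "variable_exponent q" "AE x in lebesgue. 1 / q x = 1 / p x - \<theta>"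
    using assms by (auto simp: exponent_pairs_def exponents_P_def)
  have "(\<lambda>x. q x * (1 - \<theta>)) = (\<lambda>x. q x * (real CARD('n) - \<beta>) / real CARD('n))"
    by (auto simp: \<theta>_def field_simps)
  then show "(\<lambda>x. q x * (1 - \<theta>)) \<in> exponents_B" using assms by (simp add: exponent_pairs_def)
qed

lemma AE_cong_modular:
  assumes "AE x in lebesgue. (\<bar>f x\<bar> / r) powr p x = (\<bar>g x\<bar> / s) powr q x"
  shows "modular p f r = modular q g s"
  unfolding modular_def using assms by (intro nn_integral_cong_AE) auto

text \<open>Replaces the extended valued maximal function by a real measurable majorant V, equal to
  it wherever it is finite, so that real powers can be formed.\<close>

lemma exponents_B_maximal:
  assumes r: "r \<in> exponents_B"
  shows "\<exists>C>0. \<forall>g. g \<in> borel_measurable lebesgue \<longrightarrow> modular r g 1 \<le> 1 \<longrightarrow>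
      (\<exists>V. V \<in> borel_measurable lebesgue \<and> (\<forall>x. 0 \<le> V x) \<and> modular r V C \<le> 1 \<and>
        (AE x in lebesgue. maximal g x \<le> ennreal (V x)))"
proof -
  have rv: "variable_exponent r" and M: "bounded_operator (\<lambda>f x. enn2ereal (maximal f x)) r r"
    using r by (auto simp: exponents_B_def exponents_P_def)
  obtain C where C: "0 < C" "\<And>f s. f \<in> borel_measurable lebesgue \<Longrightarrow> 0 < s \<Longrightarrow> modular r f s \<le> 1 \<Longrightarrow>
      finite_ae (\<lambda>x. enn2ereal (maximal f x)) \<and>
      (\<lambda>x. real_of_ereal (enn2ereal (maximal f x))) \<in> borel_measurable lebesgue \<and>
      modular r (\<lambda>x. real_of_ereal (enn2ereal (maximal f x))) (C * s) \<le> 1"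
    using bounded_operatorD[OF rv M] by blast
  show ?thesis
  proof (intro exI[of _ C] conjI[OF C(1)] allI impI)
    fix g assume g: "g \<in> borel_measurable lebesgue" "modular r g 1 \<le> 1"
    let ?V = "\<lambda>x. real_of_ereal (enn2ereal (maximal g x))"
    note Cg = C(2)[OF g(1) zero_less_one g(2)]
    have "AE x in lebesgue. maximal g x \<le> ennreal (?V x)"
      using conjunct1[OF Cg] unfolding finite_ae_def
    proof eventually_elim
      case (elim x)
      then show ?case by (cases "maximal g x") (auto simp: enn2ereal_ennreal)
    qed
    then show "\<exists>V. V \<in> borel_measurable lebesgue \<and> (\<forall>x. 0 \<le> V x) \<and> modular r V C \<le> 1 \<and>
        (AE x in lebesgue. maximal g x \<le> ennreal (V x))"
      using Cg by (intro exI[of _ ?V]) (auto simp: real_of_ereal_pos)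
  qed
qed

lemma modular_powr:
  assumes "\<And>x. 0 \<le> V x" "0 < s" "0 < C"
  shows "modular q (\<lambda>x. s * V x powr a) (C powr a * s) = modular (\<lambda>x. q x * a) V C"
proof (intro AE_cong_modular AE_I2)
  fix x
  have "\<bar>s * V x powr a\<bar> / (C powr a * s) = (V x / C) powr a"
    using assms by (simp add: abs_mult powr_divide)
  then show "(\<bar>s * V x powr a\<bar> / (C powr a * s)) powr q x = (\<bar>V x\<bar> / C) powr (q x * a)"
    using assms by (simp add: powr_powr mult.commute)
qed

text \<open>Jensen's inequality transfers the boundedness of the maximal operator from the exponent
  \<open>q (1 - \<theta>)\<close> to the larger exponent \<open>q\<close>.\<close>

lemma maximal_modular_bound:
  fixes q :: "real ^ 'n \<Rightarrow> real"
  assumes th: "0 < \<theta>" "\<theta> < 1" and r: "(\<lambda>x. q x * (1 - \<theta>)) \<in> exponents_B"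
  shows "\<exists>C>0. \<forall>h s. h \<in> borel_measurable lebesgue \<longrightarrow> 0 < s \<longrightarrow> modular q h s \<le> 1 \<longrightarrow>
      (\<exists>G. G \<in> borel_measurable lebesgue \<and> (\<forall>x. 0 \<le> G x) \<and> modular q G (C * s) \<le> 1 \<and>
        (AE x in lebesgue. maximal h x \<le> ennreal (G x)))"
proof -
  define a where "a = 1 - \<theta>"
  have a: "0 < a" "a < 1" "\<theta> = 1 - a" using th by (auto simp: a_def)
  obtain C where C: "0 < C" "\<And>g. g \<in> borel_measurable lebesgue \<Longrightarrow> modular (\<lambda>x. q x * a) g 1 \<le> 1 \<Longrightarrow>
      \<exists>V. V \<in> borel_measurable lebesgue \<and> (\<forall>x. 0 \<le> V x) \<and> modular (\<lambda>x. q x * a) V C \<le> 1 \<and>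
        (AE x in lebesgue. maximal g x \<le> ennreal (V x))"
    using exponents_B_maximal[OF r] unfolding a_def by blast
  show ?thesis
  proof (intro exI[of _ "C powr a"] conjI[OF _ allI[OF allI]] impI)
    show "0 < C powr a" using C by simp
    fix h and s :: real
    assume h [measurable]: "h \<in> borel_measurable lebesgue" and s: "0 < s" and h1: "modular q h s \<le> 1"
    \<comment> \<open>Chosen so that the modular of g for the exponent q (1 - \<theta>) is the
      modular of h at scale s for the exponent q.\<close>
    define g where "g = (\<lambda>x. (\<bar>h x\<bar> / s) powr (1 / a))"
    have g [measurable]: "g \<in> borel_measurable lebesgue" by (simp add: g_def)
    have "modular (\<lambda>x. q x * a) g 1 = modular q h s"
      using a s by (intro AE_cong_modular AE_I2) (simp add: g_def powr_powr)
    then obtain V where V: "V \<in> borel_measurable lebesgue" "\<And>x. 0 \<le> V x" "modular (\<lambda>x. q x * a) V C \<le> 1"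
        "AE x in lebesgue. maximal g x \<le> ennreal (V x)"
      using C(2)[OF g] h1 by auto
    let ?G = "\<lambda>x. s * V x powr a"
    have "AE x in lebesgue. maximal h x \<le> ennreal (?G x)"
      using V(4)
    proof eventually_elim
      case (elim x)
      show ?case unfolding maximal_eq
      proof (rule SUP_least, clarify)
        fix Q assume Q: "Q \<in> cubes" "x \<in> Q"
        \<comment> \<open>Jensen's inequality is obtained from \<open>avg_Holder\<close> with the
          constant 1 as first factor.\<close>
        have "avg Q h = avg Q (\<lambda>y. s * (1 powr \<theta> * g y powr (1 - \<theta>)))"
          unfolding avg_def using a s
          by (intro arg_cong2[where f = "(/)"] nn_integral_cong) (auto simp: g_def powr_powr)
        also have "\<dots> = ennreal s * avg Q (\<lambda>y. 1 powr \<theta> * g y powr (1 - \<theta>))"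
          using s by (subst avg_cmult[OF Q(1)]) auto
        also have "\<dots> \<le> ennreal s * ennreal (V x powr a)"
        proof (rule mult_left_mono[OF ennreal_le_powr_limit[OF V(2) a(1)]])
          fix W assume W: "V x < W"
          then have "0 < W" using V(2)[of x] by linarith
          have "avg Q g \<le> maximal g x" by (intro avg_le_maximal Q)
          also have "\<dots> \<le> ennreal W" using elim W by (meson ennreal_leI less_imp_le order_trans)
          finally have "avg Q g \<le> ennreal W" .
          then have "avg Q (\<lambda>y. 1 powr \<theta> * g y powr (1 - \<theta>)) \<le> ennreal (1 powr \<theta> * W powr (1 - \<theta>))"
            using th \<open>0 < W\<close> by (intro avg_Holder Q(1)) (auto simp: avg_const[OF Q(1)] g_def)
          then show "avg Q (\<lambda>y. 1 powr \<theta> * g y powr (1 - \<theta>)) \<le> ennreal (W powr a)"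
            by (simp add: a_def)
        qed simp
        finally show "avg Q h \<le> ennreal (s * V x powr a)" using s by (simp add: ennreal_mult)
      qed
    qed
    then show "\<exists>G. G \<in> borel_measurable lebesgue \<and> (\<forall>x. 0 \<le> G x) \<and> modular q G (C powr a * s) \<le> 1 \<and>
        (AE x in lebesgue. maximal h x \<le> ennreal (G x))"
      using V s C(1) modular_powr[of V s C q a] by (intro exI[of _ ?G]) auto
  qed
qed

text \<open>Hoelder's inequality for \<open>|f| = (|f|\<^sup>p)\<^sup>\<theta> (|f|\<^bsup>p/r\<^esup>)\<^bsup>1-\<theta>\<^esup>\<close> with \<open>r = q (1 - \<theta>)\<close> bounds the fractional
  maximal function by a power of the maximal function of \<open>|f|\<^bsup>p/r\<^esup>\<close>.\<close>

lemma fractional_maximal_modular_bound: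
  fixes p q :: "real ^ 'n \<Rightarrow> real"
  assumes th: "0 < \<theta>" "\<theta> < 1" and r: "(\<lambda>x. q x * (1 - \<theta>)) \<in> exponents_B"
    and p: "variable_exponent p" and q: "variable_exponent q"
    and pq: "AE x in lebesgue. 1 / q x = 1 / p x - \<theta>"
  shows "\<exists>C>0. \<forall>f s. f \<in> borel_measurable lebesgue \<longrightarrow> 0 < s \<longrightarrow> modular p f s \<le> 1 \<longrightarrow>
      (\<exists>G. G \<in> borel_measurable lebesgue \<and> (\<forall>x. 0 \<le> G x) \<and> modular q G (C * s) \<le> 1 \<and>
        (AE x in lebesgue. \<forall>Q\<in>cubes. x \<in> Q \<longrightarrow> ennreal (measure lebesgue Q powr \<theta>) * avg Q f \<le> ennreal (G x)))"
proof -
  define a where "a = 1 - \<theta>"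
  have a: "0 < a" "a < 1" "\<theta> = 1 - a" using th by (auto simp: a_def)
  obtain C where C: "0 < C" "\<And>g. g \<in> borel_measurable lebesgue \<Longrightarrow> modular (\<lambda>x. q x * a) g 1 \<le> 1 \<Longrightarrow>
      \<exists>V. V \<in> borel_measurable lebesgue \<and> (\<forall>x. 0 \<le> V x) \<and> modular (\<lambda>x. q x * a) V C \<le> 1 \<and>
        (AE x in lebesgue. maximal g x \<le> ennreal (V x))"
    using exponents_B_maximal[OF r] unfolding a_def by blast
  have [measurable]: "p \<in> borel_measurable lebesgue" "q \<in> borel_measurable lebesgue"
    and pq1: "\<And>x. 1 \<le> p x" "\<And>x. 1 \<le> q x" using p q by (auto simp: variable_exponent_def)
  show ?thesis
  proof (intro exI[of _ "C powr a"] conjI[OF _ allI[OF allI]] impI)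
    show "0 < C powr a" using C by simp
    fix f and s :: real
    assume f [measurable]: "f \<in> borel_measurable lebesgue" and s: "0 < s" and f1: "modular p f s \<le> 1"
    \<comment> \<open>The relation between p and q says that p \<theta> + p/q = 1 a.e., so
      u^\<theta> g^(1-\<theta>) = |f|/s. Here u has integral at most 1, and g has the same modular
      for q (1 - \<theta>) as f has for p at scale s.\<close>
    define u where "u = (\<lambda>x. (\<bar>f x\<bar> / s) powr p x)"
    define g where "g = (\<lambda>x. (\<bar>f x\<bar> / s) powr (p x / (q x * a)))"
    have g [measurable]: "g \<in> borel_measurable lebesgue" by (simp add: g_def)
    have u [measurable]: "u \<in> borel_measurable lebesgue" by (simp add: u_def)
    have "modular (\<lambda>x. q x * a) g 1 = modular p f s"
    proof (intro AE_cong_modular AE_I2)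
      fix x show "(\<bar>g x\<bar> / 1) powr (q x * a) = (\<bar>f x\<bar> / s) powr p x"
        using a pq1(2)[of x] by (simp add: g_def powr_powr)
    qed
    then obtain V where V: "V \<in> borel_measurable lebesgue" "\<And>x. 0 \<le> V x" "modular (\<lambda>x. q x * a) V C \<le> 1"
        "AE x in lebesgue. maximal g x \<le> ennreal (V x)"
      using C(2)[OF g] f1 by auto
    have f_eq: "AE y in lebesgue. \<bar>f y\<bar> = s * (u y powr \<theta> * g y powr (1 - \<theta>))"
      using pq
    proof eventually_elim
      case (elim y)
      have "p y * \<theta> + p y / q y = p y * (\<theta> + 1 / q y)" by (simp add: algebra_simps)
      also have "\<dots> = 1" using elim pq1(1)[of y] by simp
      finally have "u y powr \<theta> * g y powr (1 - \<theta>) = (\<bar>f y\<bar> / s) powr 1"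
        using a by (simp add: u_def g_def powr_powr a_def[symmetric] powr_add[symmetric])
      then show ?case using s by simp
    qed
    let ?G = "\<lambda>x. s * V x powr a"
    have "AE x in lebesgue. \<forall>Q\<in>cubes. x \<in> Q \<longrightarrow> ennreal (measure lebesgue Q powr \<theta>) * avg Q f \<le> ennreal (?G x)"
      using V(4)
    proof eventually_elim
      case (elim x)
      show ?case
      proof (intro ballI impI)
        fix Q assume Q: "Q \<in> cubes" "x \<in> Q"
        define m where "m = measure lebesgue Q"
        have m: "0 < m" using measure_cubes_pos[OF Q(1)] by (simp add: m_def)
        \<comment> \<open>The power \<theta> of this bound 1/m cancels the factor m^\<theta> of the
          fractional average.\<close>
        have avu: "avg Q u \<le> ennreal (1 / m)"
        proof -
          have "(\<integral>\<^sup>+y\<in>Q. ennreal \<bar>u y\<bar> \<partial>lebesgue) \<le> modular p f s"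
            unfolding modular_def u_def by (intro nn_integral_mono) (auto simp: indicator_def)
          then have "avg Q u \<le> 1 / ennreal m"
            unfolding avg_def emeasure_cubes[OF Q(1)] m_def
            by (intro divide_right_mono_ennreal) (rule order_trans[OF _ f1])
          then show ?thesis using m by (simp add: divide_ennreal flip: ennreal_1)
        qed
        have "avg Q f = avg Q (\<lambda>y. s * (u y powr \<theta> * g y powr (1 - \<theta>)))"
          unfolding avg_def using f_eq s
          by (intro arg_cong2[where f = "(/)"] nn_integral_cong_AE) (auto simp: abs_mult)
        also have "\<dots> = ennreal s * avg Q (\<lambda>y. u y powr \<theta> * g y powr (1 - \<theta>))"
          using s by (subst avg_cmult[OF Q(1)]) auto
        also have "ennreal (m powr \<theta>) * \<dots> = ennreal s * (ennreal (m powr \<theta>) * avg Q (\<lambda>y. u y powr \<theta> * g y powr (1 - \<theta>)))"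
          by (simp add: mult_ac)
        also have "\<dots> \<le> ennreal s * ennreal (V x powr a)"
        proof (rule mult_left_mono[OF ennreal_le_powr_limit[OF V(2) a(1)]])
          fix W assume W: "V x < W"
          then have "0 < W" using V(2)[of x] by linarith
          have "avg Q g \<le> maximal g x" by (intro avg_le_maximal Q)
          also have "\<dots> \<le> ennreal W" using elim W by (meson ennreal_leI less_imp_le order_trans)
          finally have "avg Q g \<le> ennreal W" .
          then have "avg Q (\<lambda>y. u y powr \<theta> * g y powr (1 - \<theta>)) \<le> ennreal ((1 / m) powr \<theta> * W powr (1 - \<theta>))"
            using th \<open>0 < W\<close> m avu by (intro avg_Holder Q(1)) (auto simp: g_def u_def)
          then have "ennreal (m powr \<theta>) * avg Q (\<lambda>y. u y powr \<theta> * g y powr (1 - \<theta>))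
            \<le> ennreal (m powr \<theta>) * ennreal ((1 / m) powr \<theta> * W powr (1 - \<theta>))"
            by (intro mult_left_mono) auto
          also have "\<dots> = ennreal (W powr a)"
            using m by (simp add: a_def powr_divide flip: ennreal_mult)
          finally show "ennreal (m powr \<theta>) * avg Q (\<lambda>y. u y powr \<theta> * g y powr (1 - \<theta>)) \<le> ennreal (W powr a)" .
        qed simp
        finally show "ennreal (measure lebesgue Q powr \<theta>) * avg Q f \<le> ennreal (s * V x powr a)"
          using s by (simp add: ennreal_mult m_def)
      qed
    qed
    then show "\<exists>G. G \<in> borel_measurable lebesgue \<and> (\<forall>x. 0 \<le> G x) \<and> modular q G (C powr a * s) \<le> 1 \<and>
        (AE x in lebesgue. \<forall>Q\<in>cubes. x \<in> Q \<longrightarrow> ennreal (measure lebesgue Q powr \<theta>) * avg Q f \<le> ennreal (G x))"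
      using V s C(1) modular_powr[of V s C q a] by (intro exI[of _ ?G]) auto
  qed
qed

section \<open>The sharp maximal function and its commutator\<close>

lemma bounded_subset_cube:
  fixes K :: "(real ^ 'n) set"
  assumes "bounded K" obtains Q where "Q \<in> cubes" "K \<subseteq> Q"
proof -
  obtain B where B: "0 < B" "\<And>x. x \<in> K \<Longrightarrow> norm x \<le> B" using assms by (auto simp: bounded_pos)
  have "K \<subseteq> cube (\<chi> i. - 2 * B) (4 * B)"
  proof
    fix x assume "x \<in> K"
    then have "\<bar>x $ i\<bar> \<le> B" for i using B(2) component_le_norm_cart[of x i] by (meson order_trans)
    then have "- 2 * B < x $ i \<and> x $ i < - 2 * B + 4 * B" for i using B(1) by (smt (verit))
    then show "x \<in> cube (\<chi> i. - 2 * B) (4 * B)" by (simp add: mem_cube)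
  qed
  then show thesis using B(1) by (intro that[of "cube (\<chi> i. - 2 * B) (4 * B)"] cube_in_cubes) auto
qed

section \<open>Local integrability in terms of averages over cubes\<close>

lemma avg_finite_iff:
  assumes "Q \<in> cubes"
  shows "avg Q f < \<infinity> \<longleftrightarrow> (\<integral>\<^sup>+y\<in>Q. ennreal \<bar>f y\<bar> \<partial>lebesgue) < \<infinity>"
  using nn_integral_eq_avg[OF assms, of f] emeasure_cubes_pos[OF assms] emeasure_cubes_finite[OF assms]
  by (auto simp: ennreal_mult_less_top ennreal_mult_eq_top_iff less_top)

lemma set_integrable_avg:
  assumes "Q \<in> cubes" and [measurable]: "f \<in> borel_measurable lebesgue"
  shows "set_integrable lebesgue Q f \<longleftrightarrow> avg Q f < \<infinity>"
proof -
  have [measurable]: "Q \<in> sets lebesgue" using assms(1) by (rule sets_cubes)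
  have "(\<integral>\<^sup>+x. ennreal (norm (indicator Q x *\<^sub>R f x)) \<partial>lebesgue) = (\<integral>\<^sup>+y\<in>Q. ennreal \<bar>f y\<bar> \<partial>lebesgue)"
    by (intro nn_integral_cong) (auto simp: indicator_def)
  then show ?thesis
    by (simp add: set_integrable_def integrable_iff_bounded avg_finite_iff[OF assms(1), unfolded infinity_ennreal_def])
qed

lemma locally_integrableI:
  fixes f :: "real ^ 'n \<Rightarrow> real"
  assumes "f \<in> borel_measurable lebesgue" "\<And>Q. Q \<in> cubes \<Longrightarrow> avg Q f < \<infinity>"
  shows "locally_integrable f"
  unfolding locally_integrable_def
proof (intro allI impI)
  fix K :: "(real ^ 'n) set" assume K: "compact K"
  obtain Q where Q: "Q \<in> cubes" "K \<subseteq> Q" using bounded_subset_cube[OF compact_imp_bounded[OF K]] .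
  show "set_integrable lebesgue K f"
    using set_integrable_subset[of lebesgue Q f K] Q assms set_integrable_avg[OF Q(1)] K
    by (simp add: sets_completionI_sets borel_compact)
qed

lemma locally_integrableD:
  fixes f :: "real ^ 'n \<Rightarrow> real"
  assumes f: "locally_integrable f"
  shows "f \<in> borel_measurable lebesgue" "Q \<in> cubes \<Longrightarrow> avg Q f < \<infinity>"
proof -
  have int: "set_integrable lebesgue (cball 0 (real k)) f" for k
    using f by (auto simp: locally_integrable_def)
  show fm: "f \<in> borel_measurable lebesgue"
  proof (rule borel_measurable_LIMSEQ_real)
    fix x :: "real ^ 'n"
    have "eventually (\<lambda>k. indicator (cball 0 (real k)) x *\<^sub>R f x = f x) sequentially"
      using eventually_ge_at_top[of "nat \<lceil>norm x\<rceil>"] by eventually_elim (auto simp: indicator_def)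
    then show "(\<lambda>k. indicator (cball 0 (real k)) x *\<^sub>R f x) \<longlonglongrightarrow> f x" by (rule tendsto_eventually)
  next
    show "(\<lambda>x. indicator (cball 0 (real k)) x *\<^sub>R f x) \<in> borel_measurable lebesgue" for k
      using int[of k] unfolding set_integrable_def by (rule borel_measurable_integrable)
  qed
  assume Q: "Q \<in> cubes"
  then have "bounded Q" by (auto simp: cubes_def)
  then obtain B where "Q \<subseteq> cball 0 B" by (auto simp: bounded_iff subset_eq)
  then have "set_integrable lebesgue Q f"
    using f set_integrable_subset[of lebesgue "cball 0 B" f Q] sets_cubes[OF Q]
    by (auto simp: locally_integrable_def)
  then show "avg Q f < \<infinity>" using set_integrable_avg[OF Q fm] by simp
qed

section \<open>Means, mean oscillations and the sharp maximal function\<close>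

lemma mean_cmult: "mean Q (\<lambda>y. c * f y) = c * mean Q f"
  by (simp add: mean_def)

lemma mean_const: "Q \<in> cubes \<Longrightarrow> mean Q (\<lambda>_. c) = c"
  using measure_cubes_pos[of Q] sets_cubes[of Q] emeasure_cubes_finite[of Q]
  by (simp add: mean_def set_lebesgue_integral_def)

lemma avg_diff_finite:
  assumes "Q \<in> cubes" "u \<in> borel_measurable lebesgue" "v \<in> borel_measurable lebesgue"
    "avg Q u < \<infinity>" "avg Q v < \<infinity>"
  shows "avg Q (\<lambda>y. u y - v y) < \<infinity>"
  using avg_triangle[OF assms(1-3), of "\<lambda>y. u y - v y"] assms(4,5)
  by (auto intro: le_less_trans simp: abs_triangle_ineq4)

lemma mean_diff:
  assumes "Q \<in> cubes" "u \<in> borel_measurable lebesgue" "v \<in> borel_measurable lebesgue"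
    "avg Q u < \<infinity>" "avg Q v < \<infinity>"
  shows "mean Q (\<lambda>y. u y - v y) = mean Q u - mean Q v"
  using assms set_integrable_avg[OF assms(1)]
  by (simp add: mean_def diff_divide_distrib set_integral_diff)

lemma abs_mean_le_avg:
  assumes Q: "Q \<in> cubes" and f: "f \<in> borel_measurable lebesgue"
  shows "ennreal \<bar>mean Q f\<bar> \<le> avg Q f"
proof (cases "avg Q f < \<infinity>")
  case True
  then have int: "integrable lebesgue (\<lambda>x. indicator Q x *\<^sub>R f x)"
    using set_integrable_avg[OF Q f] by (simp add: set_integrable_def)
  have "ennreal \<bar>LINT y:Q|lebesgue. f y\<bar> \<le> (\<integral>\<^sup>+x. ennreal (norm (indicator Q x *\<^sub>R f x)) \<partial>lebesgue)"
    using integral_norm_bound_ennreal[OF int] by (simp add: set_lebesgue_integral_def)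
  also have "\<dots> = (\<integral>\<^sup>+y\<in>Q. ennreal \<bar>f y\<bar> \<partial>lebesgue)"
    by (intro nn_integral_cong) (auto simp: indicator_def)
  finally have "ennreal \<bar>LINT y:Q|lebesgue. f y\<bar> / ennreal (measure lebesgue Q) \<le> avg Q f"
    unfolding avg_def emeasure_cubes[OF Q] by (intro divide_right_mono_ennreal)
  then show ?thesis using measure_cubes_pos[OF Q] by (simp add: mean_def divide_ennreal)
qed (simp add: not_less top_unique)

text \<open>The mean oscillation. For measurable f not integrable on a cube the mean is 0 by
  convention, and the value is then \<infinity>.\<close>

definition osc :: "(real ^ 'n) set \<Rightarrow> (real ^ 'n \<Rightarrow> real) \<Rightarrow> ennreal" where
  "osc Q f = avg Q (\<lambda>y. f y - mean Q f)"

lemma sharp_maximal_eq: "sharp_maximal f x = (SUP Q \<in> {Q \<in> cubes. x \<in> Q}. osc Q f)"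
  by (simp add: sharp_maximal_def avg_def osc_def)

lemma osc_le_sharp_maximal: "Q \<in> cubes \<Longrightarrow> x \<in> Q \<Longrightarrow> osc Q f \<le> sharp_maximal f x"
  unfolding sharp_maximal_eq by (rule SUP_upper) auto

text \<open>The difference u - v enters twice: once pointwise and once through the difference of the
  means, which is bounded by the same average.\<close>

lemma osc_le:
  assumes Q: "Q \<in> cubes" and [measurable]: "u \<in> borel_measurable lebesgue" "v \<in> borel_measurable lebesgue"
    and fin: "avg Q u < \<infinity>" "avg Q v < \<infinity>"
  shows "osc Q u \<le> osc Q v + 2 * avg Q (\<lambda>y. u y - v y)"
proof -
  let ?d = "\<bar>mean Q u - mean Q v\<bar>"
  have "osc Q u \<le> osc Q v + avg Q (\<lambda>y. \<bar>u y - v y\<bar> + ?d)"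
    unfolding osc_def by (intro avg_triangle Q) auto
  also have "avg Q (\<lambda>y. \<bar>u y - v y\<bar> + ?d) \<le> avg Q (\<lambda>y. u y - v y) + avg Q (\<lambda>_. ?d)"
    by (intro avg_triangle Q) auto
  also have "avg Q (\<lambda>_. ?d) \<le> avg Q (\<lambda>y. u y - v y)"
    using abs_mean_le_avg[OF Q, of "\<lambda>y. u y - v y"] by (simp add: avg_const[OF Q] mean_diff[OF Q _ _ fin])
  finally show ?thesis by (simp add: mult_2 add_left_mono)
qed

lemma osc_cmult:
  assumes "Q \<in> cubes" and [measurable]: "f \<in> borel_measurable lebesgue"
  shows "osc Q (\<lambda>y. c * f y) = ennreal \<bar>c\<bar> * osc Q f"
  using avg_cmult[OF assms(1), of "\<lambda>y. f y - mean Q f" c]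
  by (simp add: osc_def mean_cmult right_diff_distrib)

lemma osc_le_avg:
  assumes Q: "Q \<in> cubes" and f: "f \<in> borel_measurable lebesgue"
  shows "osc Q f \<le> 2 * avg Q f"
proof (cases "avg Q f < \<infinity>")
  case True
  then show ?thesis
    using osc_le[OF Q f, of "\<lambda>_. 0"] avg_const[OF Q, of 0] mean_const[OF Q, of 0] by (simp add: osc_def)
qed (simp add: not_less top_unique ennreal_mult_top)

lemma sharp_maximal_cmult:
  assumes "f \<in> borel_measurable lebesgue" "0 \<le> c"
  shows "sharp_maximal (\<lambda>y. c * f y) x = ennreal c * sharp_maximal f x"
proof -
  have "(SUP Q \<in> {Q \<in> cubes. x \<in> Q}. osc Q (\<lambda>y. c * f y)) = (SUP Q \<in> {Q \<in> cubes. x \<in> Q}. ennreal c * osc Q f)"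
    using assms by (intro SUP_cong) (auto simp: osc_cmult)
  then show ?thesis by (simp add: sharp_maximal_eq SUP_mult_left_ennreal)
qed

lemma sharp_maximal_le:
  assumes "u \<in> borel_measurable lebesgue" "v \<in> borel_measurable lebesgue"
    and "\<And>Q. Q \<in> cubes \<Longrightarrow> x \<in> Q \<Longrightarrow> avg Q u < \<infinity> \<and> avg Q v < \<infinity> \<and> avg Q (\<lambda>y. u y - v y) \<le> H"
  shows "sharp_maximal u x \<le> sharp_maximal v x + 2 * H"
  unfolding sharp_maximal_eq[of u]
proof (rule SUP_least, clarify)
  fix Q assume Q: "Q \<in> cubes" "x \<in> Q"
  note fin = assms(3)[OF Q]
  have "osc Q u \<le> osc Q v + 2 * avg Q (\<lambda>y. u y - v y)"
    using fin by (intro osc_le Q assms) auto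
  also have "\<dots> \<le> sharp_maximal v x + 2 * H"
    using fin by (intro add_mono mult_left_mono osc_le_sharp_maximal Q) auto
  finally show "osc Q u \<le> sharp_maximal v x + 2 * H" .
qed

lemma avg_minus_commute: "avg Q (\<lambda>y. u y - v y) = avg Q (\<lambda>y. v y - u y)"
  by (simp add: avg_def abs_minus_commute)

text \<open>Cubes have positive measure. Hence an a.e. bound of a cube average by a real function
  can be read off at one point and makes the average finite.\<close>

lemma AE_cubes_ex:
  assumes "AE x in lebesgue. P x" "Q \<in> cubes" shows "\<exists>x\<in>Q. P x"
proof (rule ccontr)
  assume "\<not> ?thesis"
  then have "AE x in lebesgue. x \<notin> Q" using assms(1) by (elim AE_mp) (auto intro!: AE_I2)
  then have "emeasure lebesgue Q = 0"
    using sets_cubes[OF assms(2)] AE_iff_null_sets[of Q lebesgue] by auto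
  then show False using emeasure_cubes_pos[OF assms(2)] by simp
qed

lemma commutator_sharp_measurable:
  assumes [measurable]: "b \<in> borel_measurable lebesgue"
  shows "(\<lambda>x. real_of_ereal (commutator_sharp b f x)) \<in> borel_measurable lebesgue"
proof -
  have [measurable]: "sharp_maximal h \<in> borel_measurable lebesgue" for h :: "real ^ 'n \<Rightarrow> real"
    using borel_measurable_sharp_maximal[of h] by (auto intro: measurable_completion)
  show ?thesis unfolding commutator_sharp_def by measurable
qed

lemma commutator_bounded:
  fixes b :: "real ^ 'n \<Rightarrow> real"
  assumes b: "locally_integrable b" and \<beta>: "\<beta> < 1" and pq: "(p, q) \<in> exponent_pairs \<beta>"
    and lip: "b \<in> lipschitz_space \<beta>" and nn: "AE x in lebesgue. 0 \<le> b x"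
  shows "bounded_operator (commutator_sharp b) p q"
proof -
  define n where "n = real CARD('n)"
  define \<theta> where "\<theta> = \<beta> / n"
  have n: "0 < n" by (simp add: n_def)
  note pq' = exponent_pairsD[OF pq \<beta>, folded n_def, folded \<theta>_def]
  have \<beta>0: "0 < \<beta>" using pq by (simp add: exponent_pairs_def)
  note bm [measurable] = locally_integrableD(1)[OF b]
  obtain g K0 where g: "AE x in lebesgue. b x = g x" "\<And>x y. \<bar>g x - g y\<bar> \<le> K0 * norm (x - y) powr \<beta>"
    using lip by (auto simp: lipschitz_space_def)
  define K where "K = \<bar>K0\<bar>"
  have K: "0 \<le> K" "\<And>x y. \<bar>g x - g y\<bar> \<le> K * norm (x - y) powr \<beta>"
    using order_trans[OF g(2) mult_right_mono[OF abs_ge_self]] by (auto simp: K_def)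
  obtain C where C: "0 < C" "\<And>f s. f \<in> borel_measurable lebesgue \<Longrightarrow> 0 < s \<Longrightarrow> modular p f s \<le> 1 \<Longrightarrow>
      \<exists>G. G \<in> borel_measurable lebesgue \<and> (\<forall>x. 0 \<le> G x) \<and> modular q G (C * s) \<le> 1 \<and>
        (AE x in lebesgue. \<forall>Q\<in>cubes. x \<in> Q \<longrightarrow> ennreal (measure lebesgue Q powr \<theta>) * avg Q f \<le> ennreal (G x))"
    using fractional_maximal_modular_bound[OF pq'(1,2,6,3,4,5)] by blast
  \<comment> \<open>The 2 is the one from \<open>sharp_maximal_le\<close>; adding 1 keeps L positive
    when K = 0.\<close>
  define L where "L = 2 * K * n powr \<beta> + 1"
  have L: "0 < L" using K(1) by (simp add: L_def add_nonneg_pos)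
  show ?thesis
  proof (rule bounded_operatorI[OF pq'(3)])
    show "0 < L * C" using L C by simp
    fix f and s :: real
    assume f [measurable]: "f \<in> borel_measurable lebesgue" and s: "0 < s" and f1: "modular p f s \<le> 1"
    obtain G where G: "G \<in> borel_measurable lebesgue" "\<And>x. 0 \<le> G x" "modular q G (C * s) \<le> 1"
      "AE x in lebesgue. \<forall>Q\<in>cubes. x \<in> Q \<longrightarrow> ennreal (measure lebesgue Q powr \<theta>) * avg Q f \<le> ennreal (G x)"
      using C(2)[OF f s f1] by blast
    have ffin: "avg Q f < \<infinity>" if Q: "Q \<in> cubes" for Q
    proof -
      obtain x where "ennreal (measure lebesgue Q powr \<theta>) * avg Q f \<le> ennreal (G x)"
        using AE_cubes_ex[OF G(4) Q] Q by blast
      then have "ennreal (measure lebesgue Q powr \<theta>) * avg Q f < \<infinity>"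
        by (rule le_less_trans) simp
      then show ?thesis using measure_cubes_pos[OF Q] by (auto simp: ennreal_mult_less_top)
    qed
    have floc: "locally_integrable f" using ffin by (intro locally_integrableI f)
    have bound: "AE x in lebesgue. \<bar>commutator_sharp b f x\<bar> \<noteq> \<infinity> \<and> \<bar>real_of_ereal (commutator_sharp b f x)\<bar> \<le> L * G x"
      using g(1) nn G(4) small_cubes_bounded_AE[OF floc]
    proof eventually_elim
      case (elim x)
      then obtain B where B: "\<And>Q. Q \<in> cubes \<Longrightarrow> x \<in> Q \<Longrightarrow> measure lebesgue Q \<le> 1 \<Longrightarrow> avg Q f \<le> ennreal B"
        by blast
      define H where "H = K * n powr \<beta> * G x"
      have H: "0 \<le> H" using K(1) G(2) by (simp add: H_def)
      \<comment> \<open>With b(x) frozen, two points of a cube of side l have distance at most n l,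
        so b varies by at most K (n l)^\<beta> = K n^\<beta> |Q|^\<theta>. The power of |Q| is
        absorbed by the fractional maximal function.\<close>
      have diff: "avg Q (\<lambda>y. b x * f y - b y * f y) \<le> ennreal H" if Q: "Q \<in> cubes" "x \<in> Q" for Q
      proof -
        obtain a l where al: "0 < l" "Q = cube a l" using Q(1) by (rule cubesE)
        have "avg Q (\<lambda>y. b x * f y - b y * f y) = avg Q (\<lambda>y. (g x - g y) * f y)"
          using g(1) elim(1) by (intro AE_cong_avg) (auto simp: left_diff_distrib)
        also have "\<dots> \<le> avg Q (\<lambda>y. (K * (n * l) powr \<beta>) * f y)"
        proof (rule avg_mono)
          fix y assume "y \<in> Q"
          then have "norm (x - y) powr \<beta> \<le> (n * l) powr \<beta>"
            using Q(2) al \<beta>0 by (intro powr_mono2) (auto simp: n_def norm_diff_cube)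
          then have "\<bar>g x - g y\<bar> \<le> K * (n * l) powr \<beta>"
            using K(2)[of x y] mult_left_mono[OF _ K(1)] by (meson order_trans)
          then show "\<bar>(g x - g y) * f y\<bar> \<le> \<bar>K * (n * l) powr \<beta> * f y\<bar>"
            using K(1) by (simp add: abs_mult mult_right_mono)
        qed
        also have "\<dots> = ennreal (K * (n * l) powr \<beta>) * avg Q f"
          using K(1) by (subst avg_cmult[OF Q(1) f]) simp
        also have "K * (n * l) powr \<beta> = K * n powr \<beta> * measure lebesgue Q powr \<theta>"
        proof -
          have "measure lebesgue Q powr \<theta> = (l powr n) powr \<theta>"
            using al by (simp add: measure_cube n_def powr_realpow)
          then show ?thesis using al n by (simp add: powr_powr powr_mult \<theta>_def)
        qed
        also have "ennreal (K * n powr \<beta> * measure lebesgue Q powr \<theta>) * avg Q f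
          = ennreal (K * n powr \<beta>) * (ennreal (measure lebesgue Q powr \<theta>) * avg Q f)"
          using K(1) by (simp add: ennreal_mult mult.assoc)
        also have "\<dots> \<le> ennreal (K * n powr \<beta>) * ennreal (G x)"
          using elim(3) Q by (intro mult_left_mono) auto
        also have "\<dots> = ennreal H" using K(1) G(2) by (simp add: H_def ennreal_mult)
        finally show ?thesis .
      qed
      have bxf: "avg Q (\<lambda>y. b x * f y) < \<infinity>" if Q: "Q \<in> cubes" for Q
        using ffin[OF Q] by (simp add: avg_cmult[OF Q f] ennreal_mult_less_top)
      have bf: "avg Q (\<lambda>y. b y * f y) < \<infinity>" if Q: "Q \<in> cubes" "x \<in> Q" for Q
      proof -
        have "avg Q (\<lambda>y. b y * f y) \<le> avg Q (\<lambda>y. b x * f y) + avg Q (\<lambda>y. b x * f y - b y * f y)"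
          by (intro avg_triangle Q) auto
        also have "\<dots> < \<infinity>" using bxf[OF Q(1)] diff[OF Q] by (auto simp: less_top[symmetric] top_unique)
        finally show ?thesis .
      qed
      have le1: "sharp_maximal (\<lambda>y. b x * f y) x \<le> sharp_maximal (\<lambda>y. b y * f y) x + 2 * ennreal H"
        using bxf bf diff by (intro sharp_maximal_le) auto
      have le2: "sharp_maximal (\<lambda>y. b y * f y) x \<le> sharp_maximal (\<lambda>y. b x * f y) x + 2 * ennreal H"
        using bxf bf diff avg_minus_commute[of _ "\<lambda>y. b x * f y" "\<lambda>y. b y * f y"] by (intro sharp_maximal_le) auto
      \<comment> \<open>This finiteness prevents \<infinity> - \<infinity> in the commutator. Cubes
        of volume at most 1 are handled by B; for the others |Q|^\<theta> \<ge> 1, so G x bounds the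
        plain average too.\<close>
      have "sharp_maximal f x \<le> ennreal (2 * max B (G x))"
        unfolding sharp_maximal_eq
      proof (rule SUP_least, clarify)
        fix Q assume Q: "Q \<in> cubes" "x \<in> Q"
        have "avg Q f \<le> ennreal (max B (G x))"
        proof (cases "measure lebesgue Q \<le> 1")
          case True
          then show ?thesis using order_trans[OF B[OF Q True] ennreal_leI[of B "max B (G x)"]] by simp
        next
          case False
          then have "1 \<le> measure lebesgue Q powr \<theta>" using pq'(1) by (intro ge_one_powr_ge_zero) auto
          then have "1 * avg Q f \<le> ennreal (measure lebesgue Q powr \<theta>) * avg Q f"
            by (intro mult_right_mono) (auto simp: ennreal_leI simp flip: ennreal_1)
          also have "\<dots> \<le> ennreal (G x)" using elim(3) Q by blast
          also have "\<dots> \<le> ennreal (max B (G x))" by (intro ennreal_leI) simp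
          finally show ?thesis by simp
        qed
        then have "2 * avg Q f \<le> 2 * ennreal (max B (G x))" by (intro mult_left_mono) auto
        then show "osc Q f \<le> ennreal (2 * max B (G x))"
          using osc_le_avg[OF Q(1) f] by (auto simp: ennreal_mult' intro: order_trans)
      qed
      then obtain m where m: "sharp_maximal f x = ennreal m" "0 \<le> m"
        by (cases "sharp_maximal f x") (auto simp: top_unique)
      \<comment> \<open>Here b x \<ge> 0 enters: otherwise |b x| would come out of the sharp maximal
        function.\<close>
      have bx: "sharp_maximal (\<lambda>y. b x * f y) x = ennreal (b x * m)"
        using elim(2) m by (simp add: sharp_maximal_cmult ennreal_mult)
      have "2 * ennreal H = ennreal (2 * H)" using H by (simp add: ennreal_mult)
      note le = le1[unfolded bx this] le2[unfolded bx this]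
      have bxm: "0 \<le> b x * m" using elim(2) m(2) by simp
      from le(2) obtain m' where m': "sharp_maximal (\<lambda>y. b y * f y) x = ennreal m'" "0 \<le> m'"
        using H bxm by (cases "sharp_maximal (\<lambda>y. b y * f y) x") (auto simp: top_unique simp flip: ennreal_plus)
      have *: "commutator_sharp b f x = ereal (b x * m - m')"
        using m m' by (simp add: commutator_sharp_def enn2ereal_ennreal)
      have "\<bar>b x * m - m'\<bar> \<le> 2 * H"
        using le m' H bxm by (simp add: abs_le_iff flip: ennreal_plus)
      also have "\<dots> \<le> L * G x" using G(2)[of x] by (simp add: H_def L_def algebra_simps)
      finally show ?case by (simp add: *)
    qed
    have "modular q (\<lambda>x. real_of_ereal (commutator_sharp b f x)) (L * C * s) \<le> modular q G (C * s)"
    proof (rule modular_mono_AE[OF _ _ pq'(4)])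
      show "AE x in lebesgue. \<bar>real_of_ereal (commutator_sharp b f x)\<bar> / (L * C * s) \<le> \<bar>G x\<bar> / (C * s)"
        using bound
      proof eventually_elim
        case (elim x)
        then show ?case using L C(1) s G(2)[of x] by (simp add: field_simps)
      qed
    qed (use L C s in simp)
    moreover have "finite_ae (commutator_sharp b f)"
      unfolding finite_ae_def using bound by eventually_elim simp
    ultimately show "finite_ae (commutator_sharp b f) \<and>
      (\<lambda>x. real_of_ereal (commutator_sharp b f x)) \<in> borel_measurable lebesgue \<and>
      modular q (\<lambda>x. real_of_ereal (commutator_sharp b f x)) (L * C * s) \<le> 1"
      using G(3) by (auto simp: commutator_sharp_measurable[OF bm])
  qed
qed

section \<open>Existence of exponent pairs\<close>

lemma ess_upper_const: "ess_upper (\<lambda>_ :: real ^ 'n. c) = ereal c"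
  unfolding ess_upper_def by (rule esssup_const) simp

lemma ess_lower_const: "ess_lower (\<lambda>_ :: real ^ 'n. c) = ereal c"
proof -
  have "esssup lebesgue (\<lambda>_ :: real ^ 'n. - ereal c) = - ereal c" by (rule esssup_const) simp
  then show ?thesis by (simp add: ess_lower_def)
qed

lemma const_exponents_P: "1 < c \<Longrightarrow> (\<lambda>_ :: real ^ 'n. c) \<in> exponents_P"
  by (simp add: exponents_P_def variable_exponent_def ess_upper_const ess_lower_const)

text \<open>The strong type (2,2) estimate bounds the squared norm by a factor K. As K \<ge> 1, K
  itself serves as a bound for the operator, and no square root is taken.\<close>

lemma two_exponents_B: "(\<lambda>_ :: real ^ 'n. 2) \<in> exponents_B"
proof -
  define K where "K = real (8 * (10 * CARD('n)) ^ CARD('n))"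
  have K: "1 \<le> K"
  proof -
    have "1 \<le> 8 * (10 * CARD('n)) ^ CARD('n)" by simp
    then show ?thesis unfolding K_def by (metis of_nat_1 of_nat_mono)
  qed
  have m2: "modular (\<lambda>_. 2) f s = (\<integral>\<^sup>+x. ennreal (1 / s\<^sup>2) * ennreal ((f x)\<^sup>2) \<partial>lebesgue)"
    if "0 < s" for f :: "real ^ 'n \<Rightarrow> real" and s
    using that unfolding modular_def
    by (intro nn_integral_cong) (simp add: power_divide flip: ennreal_mult)
  have "bounded_operator (\<lambda>f x. enn2ereal (maximal f x)) (\<lambda>_ :: real ^ 'n. 2) (\<lambda>_. 2)"
  proof (rule bounded_operatorI)
    show "variable_exponent (\<lambda>_ :: real ^ 'n. 2)" by (simp add: variable_exponent_def)
    show "0 < K" using K by simp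
    fix f :: "real ^ 'n \<Rightarrow> real" and s :: real
    assume f [measurable]: "f \<in> borel_measurable lebesgue" and s: "0 < s" and f1: "modular (\<lambda>_. 2) f s \<le> 1"
    have M [measurable]: "maximal f \<in> borel_measurable lebesgue"
      using borel_measurable_maximal[of f] by (auto intro: measurable_completion)
    let ?V = "\<lambda>x. real_of_ereal (enn2ereal (maximal f x))"
    have "(\<integral>\<^sup>+x. ennreal ((f x)\<^sup>2) \<partial>lebesgue) = (\<integral>\<^sup>+x. ennreal (s\<^sup>2) * (ennreal (1 / s\<^sup>2) * ennreal ((f x)\<^sup>2)) \<partial>lebesgue)"
      using s by (intro nn_integral_cong) (simp flip: ennreal_mult)
    also have "\<dots> = ennreal (s\<^sup>2) * modular (\<lambda>_. 2) f s"
      unfolding m2[OF s] by (rule nn_integral_cmult) measurable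
    also have "\<dots> \<le> ennreal (s\<^sup>2) * 1" by (intro mult_left_mono f1) simp
    finally have "(\<integral>\<^sup>+x. ennreal ((f x)\<^sup>2) \<partial>lebesgue) \<le> ennreal (s\<^sup>2)" by simp
    then have "ennreal K * (\<integral>\<^sup>+x. ennreal ((f x)\<^sup>2) \<partial>lebesgue) \<le> ennreal K * ennreal (s\<^sup>2)"
      by (intro mult_left_mono) auto
    then have int: "(\<integral>\<^sup>+x. (maximal f x)\<^sup>2 \<partial>lebesgue) \<le> ennreal (K * s\<^sup>2)"
      using maximal_L2[OF f] K by (simp add: K_def ennreal_mult)
    then have "(\<integral>\<^sup>+x. (maximal f x)\<^sup>2 \<partial>lebesgue) \<noteq> \<infinity>" by (auto simp: top_unique)
    then have "AE x in lebesgue. (maximal f x)\<^sup>2 \<noteq> \<infinity>" by (intro nn_integral_PInf_AE) measurable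
    then have fin: "AE x in lebesgue. maximal f x \<noteq> \<infinity>"
      by eventually_elim (auto simp: power2_eq_square)
    have "modular (\<lambda>_. 2) ?V (K * s) = (\<integral>\<^sup>+x. ennreal (1 / (K * s)\<^sup>2) * ennreal ((?V x)\<^sup>2) \<partial>lebesgue)"
      using K s by (intro m2) simp
    also have "\<dots> = (\<integral>\<^sup>+x. ennreal (1 / (K * s)\<^sup>2) * (maximal f x)\<^sup>2 \<partial>lebesgue)"
    proof (rule nn_integral_cong_AE, use fin in eventually_elim)
      case (elim x)
      then show ?case by (cases "maximal f x") (auto simp: enn2ereal_ennreal ennreal_power)
    qed
    also have "\<dots> = ennreal (1 / (K * s)\<^sup>2) * (\<integral>\<^sup>+x. (maximal f x)\<^sup>2 \<partial>lebesgue)"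
      by (rule nn_integral_cmult) measurable
    also have "\<dots> \<le> ennreal (1 / (K * s)\<^sup>2) * ennreal (K * s\<^sup>2)" by (intro mult_left_mono int) simp
    also have "\<dots> = ennreal (1 / K)"
      using K s by (simp add: power2_eq_square flip: ennreal_mult)
    also have "\<dots> \<le> 1" using K by (simp add: divide_le_eq)
    finally have "modular (\<lambda>_. 2) ?V (K * s) \<le> 1" .
    moreover have "finite_ae (\<lambda>x. enn2ereal (maximal f x))"
      unfolding finite_ae_def using fin
    proof eventually_elim
      case (elim x)
      then show ?case by (cases "maximal f x") (auto simp: enn2ereal_ennreal)
    qed
    ultimately show "finite_ae (\<lambda>x. enn2ereal (maximal f x)) \<and> ?V \<in> borel_measurable lebesgue \<and>
        modular (\<lambda>_. 2) ?V (K * s) \<le> 1"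
      by simp
  qed
  then show ?thesis by (simp add: exponents_B_def const_exponents_P)
qed

text \<open>Constant exponents: q (n - \<beta>)/n = 2 determines q = 2 n/(n - \<beta>), and then 1/p
  = 1/q + \<beta>/n determines p = 2 n/(n + \<beta>), which exceeds 1 because \<beta> < n.\<close>

lemma exponent_pairs_nonempty:
  assumes "0 < \<beta>" "\<beta> < 1"
  shows "\<exists>p q. (p, q) \<in> (exponent_pairs \<beta> :: ((real ^ 'n \<Rightarrow> real) \<times> (real ^ 'n \<Rightarrow> real)) set)"
proof -
  define n where "n = real CARD('n)"
  have "1 \<le> n" by (simp add: n_def Suc_le_eq)
  then have n: "\<beta> < n" "0 < n" using assms by auto
  have "ereal \<beta> < ereal n / ereal (2 * n / (n + \<beta>))"
    using n assms by (simp add: field_simps)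
  moreover have "1 < 2 * n / (n + \<beta>)" "1 \<le> 2 * n / (n - \<beta>)" using n assms by (auto simp: field_simps)
  moreover have "1 / (2 * n / (n - \<beta>)) = 1 / (2 * n / (n + \<beta>)) - \<beta> / n"
    using n assms by (simp add: field_simps)
  moreover have "2 * n / (n - \<beta>) * (n - \<beta>) / n = 2" using n assms by (simp add: field_simps)
  ultimately have "(\<lambda>_ :: real ^ 'n. 2 * n / (n + \<beta>), \<lambda>_. 2 * n / (n - \<beta>)) \<in> exponent_pairs \<beta>"
    using two_exponents_B[where 'n = 'n] const_exponents_P[where 'n = 'n] assms(1)
    unfolding exponent_pairs_def n_def by (auto simp: variable_exponent_def ess_upper_const)
  then show ?thesis by blast
qed

section \<open>Testing on characteristic functions of cubes\<close>

lemma emeasure_Int_cubes: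
  assumes "Q \<in> cubes" "Q' \<in> cubes"
  shows "emeasure lebesgue (Q \<inter> Q') = ennreal (measure lebesgue (Q \<inter> Q'))"
    "emeasure lebesgue (Q - Q') = ennreal (measure lebesgue Q - measure lebesgue (Q \<inter> Q'))"
proof -
  have fm: "Q \<in> fmeasurable lebesgue" "Q' \<in> fmeasurable lebesgue"
    using assms by (auto intro!: fmeasurableI sets_cubes emeasure_cubes_finite[unfolded infinity_ennreal_def])
  then show "emeasure lebesgue (Q \<inter> Q') = ennreal (measure lebesgue (Q \<inter> Q'))"
    by (intro emeasure_eq_measure2) (auto intro: fmeasurable_Int_fmeasurable fmeasurableD)
  have "emeasure lebesgue (Q - Q') = ennreal (measure lebesgue (Q - Q'))"
    using fm by (intro emeasure_eq_measure2) (auto intro: fmeasurable_Diff fmeasurableD)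
  also have "measure lebesgue (Q - Q') = measure lebesgue Q - measure lebesgue (Q \<inter> Q')"
    using measure_Diff[OF less_imp_neq[OF emeasure_cubes_finite[OF assms(1)]], of "Q \<inter> Q'"] fm
    by (auto simp: fmeasurableD Diff_Int)
  finally show "emeasure lebesgue (Q - Q') = ennreal (measure lebesgue Q - measure lebesgue (Q \<inter> Q'))" .
qed

text \<open>If t is the fraction of the second cube covered by the first, the mean is t and the
  oscillation is 2 t (1 - t), with maximum 1/2 at t = 1/2.\<close>

lemma osc_indicator_le:
  assumes Q: "Q \<in> cubes" and Q': "Q' \<in> cubes"
  shows "osc Q' (indicator Q) \<le> ennreal (1 / 2)"
proof -
  define M where "M = measure lebesgue Q'"
  define t where "t = measure lebesgue (Q' \<inter> Q) / M"
  have [measurable]: "Q \<in> sets lebesgue" "Q' \<in> sets lebesgue" using Q Q' by (auto intro: sets_cubes)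
  have M: "0 < M" using measure_cubes_pos[OF Q'] by (simp add: M_def)
  have tM: "measure lebesgue (Q' \<inter> Q) = t * M" using M by (simp add: t_def)
  have "measure lebesgue (Q' \<inter> Q) \<le> M"
    unfolding M_def using emeasure_cubes_finite[OF Q'] by (intro measure_mono_fmeasurable) (auto intro: fmeasurableI)
  then have t: "0 \<le> t" "t \<le> 1" using M by (auto simp: t_def)
  have "(LINT y:Q'|lebesgue. indicator Q y) = (LINT y|lebesgue. indicator (Q' \<inter> Q) y :: real)"
    unfolding set_lebesgue_integral_def by (intro Bochner_Integration.integral_cong) (auto simp: indicator_def)
  then have mean: "mean Q' (indicator Q) = t"
    by (simp add: mean_def t_def M_def)
  have "(\<integral>\<^sup>+y\<in>Q'. ennreal \<bar>indicator Q y - t\<bar> \<partial>lebesgue)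
    = (\<integral>\<^sup>+y. ennreal (1 - t) * indicator (Q' \<inter> Q) y + ennreal t * indicator (Q' - Q) y \<partial>lebesgue)"
    using t by (intro nn_integral_cong) (auto simp: indicator_def)
  also have "\<dots> = ennreal (1 - t) * emeasure lebesgue (Q' \<inter> Q) + ennreal t * emeasure lebesgue (Q' - Q)"
    by (subst nn_integral_add) (auto simp: nn_integral_cmult_indicator)
  also have "\<dots> = ennreal (1 - t) * ennreal (t * M) + ennreal t * ennreal (M - t * M)"
    unfolding emeasure_Int_cubes[OF Q' Q] tM M_def[symmetric] ..
  also have "\<dots> = ennreal (2 * (t * (1 - t)) * M)"
    using t M by (subst (1 2) ennreal_mult[symmetric]) (auto simp: mult_left_le_one_le algebra_simps simp flip: ennreal_plus)
  also have "\<dots> \<le> ennreal (1 / 2 * M)"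
  proof (intro ennreal_leI mult_right_mono)
    have "0 \<le> (2 * t - 1)\<^sup>2" by simp
    then show "2 * (t * (1 - t)) \<le> 1 / 2" by (simp add: power2_eq_square algebra_simps)
  qed (use M in simp)
  finally have "osc Q' (indicator Q) \<le> ennreal (1 / 2 * M) / ennreal M"
    unfolding osc_def avg_def mean emeasure_cubes[OF Q'] M_def by (rule divide_right_mono_ennreal)
  also have "\<dots> = ennreal (1 / 2)" using M by (subst divide_ennreal) auto
  finally show ?thesis .
qed

text \<open>Test against the cube of twice the volume of \<open>Q\<close> with the same corner.\<close>

lemma abs_mean_le_sharp_maximal:
  fixes b :: "real ^ 'n \<Rightarrow> real"
  assumes Q: "Q \<in> cubes" and b [measurable]: "b \<in> borel_measurable lebesgue" and x: "x \<in> Q"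
  shows "ennreal \<bar>mean Q b\<bar> \<le> 2 * sharp_maximal (\<lambda>y. b y * indicator Q y) x"
proof (cases "avg Q b < \<infinity>")
  case fin: True
  define n where "n = real CARD('n)"
  have n: "0 < n" by (simp add: n_def)
  obtain a l where al: "0 < l" "Q = cube a l" using Q by (rule cubesE)
  \<comment> \<open>The factor 2^(1/n) in the side doubles the volume, which makes the mean of the
    cut off function half of the mean of b.\<close>
  define l' where "l' = l * 2 powr (1 / n)"
  have l': "0 < l'" "l \<le> l'" using al n by (auto simp: l'_def ge_one_powr_ge_zero)
  define Q' where "Q' = cube a l'"
  have Q': "Q' \<in> cubes" using l' by (simp add: Q'_def cube_in_cubes)
  have sub: "Q \<subseteq> Q'" using l' unfolding al(2) Q'_def by (auto simp: mem_cube) (metis add_left_mono less_le_trans)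
  have [measurable]: "Q \<in> sets lebesgue" "Q' \<in> sets lebesgue" using Q Q' by (auto intro: sets_cubes)
  define M where "M = measure lebesgue Q"
  have M: "0 < M" using measure_cubes_pos[OF Q] by (simp add: M_def)
  have "(2 powr (1 / n)) ^ CARD('n) = (2 powr (1 / n)) powr n" by (simp add: n_def powr_realpow)
  also have "\<dots> = 2" using n by (simp add: powr_powr)
  finally have M': "measure lebesgue Q' = 2 * M"
    using al l' by (simp add: Q'_def M_def measure_cube l'_def power_mult_distrib)
  have emD: "emeasure lebesgue (Q' - Q) = ennreal M"
    using emeasure_Int_cubes(2)[OF Q' Q] sub M' by (simp add: Int_absorb1 M_def)
  define u where "u = (\<lambda>y. b y * indicator Q y)"
  define m where "m = mean Q b"
  have "(LINT y:Q'|lebesgue. u y) = (LINT y:Q|lebesgue. b y)"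
    unfolding set_lebesgue_integral_def u_def using sub
    by (intro Bochner_Integration.integral_cong) (auto simp: indicator_def)
  then have mu: "mean Q' u = m / 2" by (simp add: mean_def m_def M' M_def)
  have "ennreal \<bar>mean Q (\<lambda>y. b y - m / 2)\<bar> \<le> avg Q (\<lambda>y. b y - m / 2)"
    by (intro abs_mean_le_avg Q) auto
  also have "mean Q (\<lambda>y. b y - m / 2) = m / 2"
    using fin by (subst mean_diff[OF Q]) (auto simp: avg_const[OF Q] mean_const[OF Q] m_def)
  finally have *: "ennreal \<bar>m / 2\<bar> * ennreal M \<le> (\<integral>\<^sup>+y\<in>Q. ennreal \<bar>b y - m / 2\<bar> \<partial>lebesgue)"
    unfolding nn_integral_eq_avg[OF Q] emeasure_cubes[OF Q] M_def by (rule mult_right_mono) simp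
  \<comment> \<open>The small cube contributes at least M |m|/2, because b - m/2 has mean m/2 there;
    on the rest, of volume M, u vanishes and |u - m/2| = |m|/2.\<close>
  have "ennreal (\<bar>m\<bar> / 2 * (2 * M)) = ennreal \<bar>m / 2\<bar> * ennreal M + ennreal \<bar>m / 2\<bar> * ennreal M"
    using M by (simp flip: ennreal_mult ennreal_plus)
  also have "\<dots> \<le> (\<integral>\<^sup>+y\<in>Q. ennreal \<bar>b y - m / 2\<bar> \<partial>lebesgue) + ennreal \<bar>m / 2\<bar> * emeasure lebesgue (Q' - Q)"
    unfolding emD by (intro add_mono *) simp
  also have "\<dots> = (\<integral>\<^sup>+y. ennreal \<bar>b y - m / 2\<bar> * indicator Q y + ennreal \<bar>m / 2\<bar> * indicator (Q' - Q) y \<partial>lebesgue)"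
    by (subst nn_integral_add) (auto simp: nn_integral_cmult_indicator)
  also have "\<dots> = (\<integral>\<^sup>+y\<in>Q'. ennreal \<bar>u y - m / 2\<bar> \<partial>lebesgue)"
    using sub by (intro nn_integral_cong) (auto simp: u_def indicator_def)
  finally have "ennreal (\<bar>m\<bar> / 2 * (2 * M)) / ennreal (2 * M) \<le> osc Q' u"
    unfolding osc_def avg_def mu emeasure_cubes[OF Q'] M' by (rule divide_right_mono_ennreal)
  then have "ennreal (\<bar>m\<bar> / 2) \<le> osc Q' u" using M by (subst (asm) divide_ennreal) auto
  also have "\<dots> \<le> sharp_maximal u x" using x sub by (intro osc_le_sharp_maximal Q') auto
  finally have "2 * ennreal (\<bar>m\<bar> / 2) \<le> 2 * sharp_maximal u x" by (rule mult_left_mono) simp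
  moreover have "2 * ennreal (\<bar>m\<bar> / 2) = ennreal \<bar>m\<bar>"
    by (metis abs_ge_zero divide_nonneg_nonneg ennreal_mult' ennreal_numeral nonzero_mult_div_cancel_left
        times_divide_eq_right zero_le_numeral zero_neq_numeral)
  ultimately show ?thesis by (simp add: u_def m_def)
next
  case False
  \<comment> \<open>The integral of a function that is not integrable is 0 by convention, so the
    mean is 0.\<close>
  then have "\<not> set_integrable lebesgue Q b" using set_integrable_avg[OF Q b] by simp
  then show ?thesis
    by (simp add: mean_def set_lebesgue_integral_def set_integrable_def not_integrable_integral_eq)
qed

text \<open>The lower bound is \<open>abs_mean_le_sharp_maximal\<close> for b = 1; the upper one
  holds for the oscillation over every cube.\<close>

lemma sharp_maximal_indicator:
  fixes Q :: "(real ^ 'n) set"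
  assumes Q: "Q \<in> cubes" "x \<in> Q"
  shows "sharp_maximal (indicator Q) x = ennreal (1 / 2)"
proof (rule antisym)
  show "sharp_maximal (indicator Q) x \<le> ennreal (1 / 2)"
    unfolding sharp_maximal_eq
  proof (rule SUP_least, clarify)
    fix Q' :: "(real ^ 'n) set" assume "Q' \<in> cubes"
    then show "osc Q' (indicator Q) \<le> ennreal (1 / 2)" by (rule osc_indicator_le[OF Q(1)])
  qed
  have ge: "1 \<le> 2 * sharp_maximal (indicator Q) x"
    using abs_mean_le_sharp_maximal[OF Q(1) _ Q(2), of "\<lambda>_. 1"] mean_const[OF Q(1), of 1] by simp
  show "ennreal (1 / 2) \<le> sharp_maximal (indicator Q) x"
  proof (cases "sharp_maximal (indicator Q) x")
    case (real r)
    then have "ennreal 1 \<le> ennreal (2 * r)"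
      using ge by (simp add: ennreal_mult)
    then have "1 / 2 \<le> r" using real(1) by (subst (asm) ennreal_le_iff) auto
    then show ?thesis unfolding real(2) by (rule ennreal_leI)
  qed simp
qed

text \<open>A positive real value makes the quotient in \<open>sharp_deviation\<close> an ordinary
  one that can be multiplied out. For positivity: a scale s \<le> 1 with modular at most 1 satisfies
  |Q| \<le> s, as the exponent is at least 1.\<close>

lemma indicator_var_norm:
  fixes Q :: "(real ^ 'n) set"
  assumes q: "variable_exponent q" and Q: "Q \<in> cubes"
  obtains k where "0 < k" "var_norm q (indicator Q) = ennreal k"
proof -
  have [measurable]: "Q \<in> sets lebesgue" using Q by (rule sets_cubes)
  define M where "M = measure lebesgue Q"
  have M: "0 < M" using measure_cubes_pos[OF Q] by (simp add: M_def)
  have q1: "1 \<le> q x" for x using q by (simp add: variable_exponent_def)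
  have "modular q (indicator Q) 1 = (\<integral>\<^sup>+x. indicator Q x \<partial>lebesgue)"
    unfolding modular_def
  proof (rule nn_integral_cong)
    fix x show "ennreal ((\<bar>indicator Q x\<bar> / 1) powr q x) = indicator Q x"
      using q1[of x] by (simp add: indicator_def)
  qed
  also have "\<dots> < \<infinity>" using emeasure_cubes_finite[OF Q] by simp
  finally have L: "indicator Q \<in> var_Lp q" by (auto simp: var_Lp_def intro!: exI[of _ 1])
  obtain r where r: "0 < r" "modular q (indicator Q) r \<le> 1" using var_Lp_modular_le_1[OF q L] by auto
  have up: "var_norm q (indicator Q) \<le> ennreal r" by (rule var_norm_le) (use r in auto)
  have "ennreal (min 1 M) \<le> ennreal s" if s: "0 < s" "modular q (indicator Q) s \<le> 1" for s
  proof (cases "s \<le> 1")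
    case True
    have "ennreal (1 / s) * emeasure lebesgue Q = (\<integral>\<^sup>+x. ennreal (1 / s) * indicator Q x \<partial>lebesgue)"
      by (simp add: nn_integral_cmult_indicator)
    also have "\<dots> \<le> modular q (indicator Q) s" unfolding modular_def
    proof (rule nn_integral_mono)
      fix x
      have "(1 / s) powr 1 \<le> (1 / s) powr q x" using s True q1[of x] by (intro powr_mono) auto
      then show "ennreal (1 / s) * indicator Q x \<le> ennreal ((\<bar>indicator Q x\<bar> / s) powr q x)"
        using s by (auto simp: indicator_def intro: ennreal_leI)
    qed
    also have "\<dots> \<le> 1" by (rule s)
    finally have "ennreal (M / s) \<le> ennreal 1"
      using s by (simp add: emeasure_cubes[OF Q] M_def flip: ennreal_mult)
    then have "M \<le> s" using s by (subst (asm) ennreal_le_iff) (auto simp: divide_le_eq)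
    then show ?thesis by (intro ennreal_leI) simp
  qed (auto intro: ennreal_leI)
  then have "ennreal (min 1 M) \<le> var_norm q (indicator Q)"
    using L by (auto simp: var_norm_def intro!: Inf_greatest)
  moreover obtain k where k: "var_norm q (indicator Q) = ennreal k" "0 \<le> k"
    using up by (cases "var_norm q (indicator Q)") (auto simp: top_unique)
  ultimately have "min 1 M \<le> k" by simp
  then show thesis using M k by (intro that[of k]) auto
qed

text \<open>Young's inequality with exponents \<open>q/p\<close> and \<open>1/(p \<theta>)\<close>.\<close>

lemma modular_indicator_le:
  fixes Q :: "(real ^ 'n) set"
  assumes Q: "Q \<in> cubes" and p: "variable_exponent p" and q: "variable_exponent q"
    and th: "0 < \<theta>" and pq: "AE x in lebesgue. 1 / q x = 1 / p x - \<theta>"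
    and k: "0 < k" "modular q (indicator Q) k \<le> 1"
  shows "modular p (indicator Q) (2 * k * measure lebesgue Q powr \<theta>) \<le> 1"
proof -
  have [measurable]: "Q \<in> sets lebesgue" using Q by (rule sets_cubes)
  define M where "M = measure lebesgue Q"
  have M: "0 < M" using measure_cubes_pos[OF Q] by (simp add: M_def)
  \<comment> \<open>Young's inequality produces two terms whose integrals over the cube are at most
    1 each. The 2 in the scale contributes (1/2)^p \<le> 1/2 and compensates for this.\<close>
  have pt: "((1 / (2 * k * M powr \<theta>)) powr p x) \<le> 1 / 2 * ((1 / k) powr q x + 1 / M)"
    if e: "1 / q x = 1 / p x - \<theta>" for x
  proof -
    have p1: "1 \<le> p x" and q1: "1 \<le> q x" using p q by (auto simp: variable_exponent_def)
    have s: "p x / q x + p x * \<theta> = 1"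
    proof -
      have "p x / q x + p x * \<theta> = p x * (1 / q x + \<theta>)" by (simp add: algebra_simps)
      also have "\<dots> = 1" using e p1 by simp
      finally show ?thesis .
    qed
    have le1: "p x / q x \<le> 1" "p x * \<theta> \<le> 1"
    proof -
      have "0 \<le> p x / q x" "0 \<le> p x * \<theta>" using p1 q1 th by auto
      then show "p x / q x \<le> 1" "p x * \<theta> \<le> 1" using s by linarith+
    qed
    define A where "A = (1 / k) powr q x"
    have A: "0 < A" using k by (simp add: A_def)
    have "(1 / (2 * k * M powr \<theta>)) powr p x = (1 / 2) powr p x * ((1 / k) powr p x * (1 / M powr \<theta>) powr p x)"
    proof -
      have "1 / (2 * k * M powr \<theta>) = 1 / 2 * (1 / k * (1 / M powr \<theta>))" by simp
      then show ?thesis using k by (simp only: powr_mult)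
    qed
    also have "(1 / k) powr p x = A powr (p x / q x)" using q1 by (simp add: A_def powr_powr)
    also have "(1 / M powr \<theta>) powr p x = (1 / M) powr (p x * \<theta>)"
      using M by (simp add: powr_divide powr_powr mult.commute)
    also have "(1 / 2) powr p x * (A powr (p x / q x) * (1 / M) powr (p x * \<theta>))
      \<le> (1 / 2) powr 1 * (p x / q x * A + p x * \<theta> * (1 / M))"
      using p1 q1 th A M s by (intro mult_mono Youngs_inequality_0 powr_mono') auto
    also have "\<dots> \<le> (1 / 2) * (1 * A + 1 * (1 / M))"
      using A M le1 p1 q1 th by (intro mult_mono add_mono) auto
    finally show ?thesis by (simp add: A_def)
  qed
  have "modular p (indicator Q) (2 * k * M powr \<theta>)
    \<le> (\<integral>\<^sup>+x. ennreal (1 / 2) * (ennreal ((\<bar>indicator Q x\<bar> / k) powr q x) + ennreal (1 / M) * indicator Q x) \<partial>lebesgue)"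
    unfolding modular_def
  proof (rule nn_integral_mono_AE, use pq in eventually_elim)
    case (elim x)
    show ?case
    proof (cases "x \<in> Q")
      case True
      have "ennreal ((1 / (2 * k * M powr \<theta>)) powr p x) \<le> ennreal (1 / 2 * ((1 / k) powr q x + 1 / M))"
        by (intro ennreal_leI pt elim)
      also have "\<dots> = ennreal (1 / 2) * (ennreal ((1 / k) powr q x) + ennreal (1 / M))"
        using M by (subst ennreal_mult) auto
      finally show ?thesis using True by simp
    next
      case False
      have "p x \<noteq> 0" using p[unfolded variable_exponent_def] by (metis not_one_le_zero)
      then show ?thesis using False by simp
    qed
  qed
  also have "\<dots> = ennreal (1 / 2) * (modular q (indicator Q) k + ennreal (1 / M) * emeasure lebesgue Q)"
    unfolding modular_def using modular_measurable[OF q, of "indicator Q" k]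
    by (subst nn_integral_cmult, simp, subst nn_integral_add) (auto simp: nn_integral_cmult_indicator)
  also have "ennreal (1 / M) * emeasure lebesgue Q = 1"
    using M by (simp add: emeasure_cubes[OF Q] M_def flip: ennreal_mult)
  also have "ennreal (1 / 2) * (modular q (indicator Q) k + 1) \<le> ennreal (1 / 2) * (1 + 1)"
    by (intro mult_left_mono add_mono k) auto
  also have "\<dots> = ennreal (1 / 2) * ennreal 2" by simp
  also have "\<dots> = 1" by (subst ennreal_mult[symmetric]) auto
  finally show ?thesis by (simp add: M_def)
qed

section \<open>From commutator bounds to deviations and their averages\<close>

definition deviation :: "(real ^ 'n \<Rightarrow> real) \<Rightarrow> (real ^ 'n) set \<Rightarrow> real ^ 'n \<Rightarrow> ereal" where
  "deviation b Q x = (ereal (b x) - 2 * enn2ereal (sharp_maximal (\<lambda>y. b y * indicator Q y) x)) * indicator Q x"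

lemma sharp_deviation_eq:
  "sharp_deviation \<beta> b q = (SUP Q \<in> cubes. 1 / ennreal (measure lebesgue Q powr (\<beta> / real CARD('n))) *
     (var_norm_ereal q (deviation b Q) / var_norm q (indicator Q)))"
  for b :: "real ^ 'n \<Rightarrow> real"
  by (simp add: sharp_deviation_def deviation_def[abs_def])

lemma deviation_measurable:
  assumes [measurable]: "b \<in> borel_measurable lebesgue" and Q: "Q \<in> cubes"
  shows "(\<lambda>x. real_of_ereal (deviation b Q x)) \<in> borel_measurable lebesgue"
proof -
  have [measurable]: "sharp_maximal h \<in> borel_measurable lebesgue" for h :: "real ^ 'n \<Rightarrow> real"
    using borel_measurable_sharp_maximal[of h] by (auto intro: measurable_completion)
  have [measurable]: "Q \<in> sets lebesgue" using Q by (rule sets_cubes)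
  show ?thesis unfolding deviation_def by measurable
qed

text \<open>On the cube \<open>sharp_maximal (indicator Q)\<close> is 1/2, so the commutator is b/2
  minus the sharp maximal function of b \<chi>. Finiteness makes that term real and allows the
  doubling.\<close>

lemma deviation_eq_commutator:
  fixes b :: "real ^ 'n \<Rightarrow> real"
  assumes Q: "Q \<in> cubes" and x: "x \<in> Q" and fin: "\<bar>commutator_sharp b (indicator Q) x\<bar> \<noteq> \<infinity>"
  shows "deviation b Q x = 2 * commutator_sharp b (indicator Q) x"
proof -
  let ?S = "enn2ereal (sharp_maximal (\<lambda>y. b y * indicator Q y) x)"
  have half: "enn2ereal (ennreal (1 / 2)) = ereal (1 / 2)" by (rule enn2ereal_ennreal) simp
  have *: "commutator_sharp b (indicator Q) x = ereal (b x / 2) - ?S"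
    unfolding commutator_sharp_def sharp_maximal_indicator[OF Q x] half by simp
  then obtain t where "?S = ereal t" using fin by (cases ?S) auto
  then show ?thesis using x by (simp add: * deviation_def numeral_eq_ereal)
qed

lemma commutator_bounded_imp_sharp_deviation:
  fixes b :: "real ^ 'n \<Rightarrow> real"
  assumes b: "b \<in> borel_measurable lebesgue" and \<beta>: "\<beta> < 1" and pq: "(p, q) \<in> exponent_pairs \<beta>"
    and bdd: "bounded_operator (commutator_sharp b) p q"
  shows "sharp_deviation \<beta> b q < \<infinity>"
proof -
  define \<theta> where "\<theta> = \<beta> / CARD('n)"
  note pq' = exponent_pairsD[OF pq \<beta>, folded \<theta>_def]
  obtain C where C: "0 < C" "\<And>f s. f \<in> borel_measurable lebesgue \<Longrightarrow> 0 < s \<Longrightarrow> modular p f s \<le> 1 \<Longrightarrow>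
      finite_ae (commutator_sharp b f) \<and>
      modular q (\<lambda>x. real_of_ereal (commutator_sharp b f x)) (C * s) \<le> 1"
    using bounded_operatorD[OF pq'(4) bdd] by blast
  have "1 / ennreal (measure lebesgue Q powr \<theta>) * (var_norm_ereal q (deviation b Q) / var_norm q (indicator Q))
    \<le> ennreal (8 * C)" if Q: "Q \<in> cubes" for Q
  proof -
    let ?I = "indicator Q :: real ^ 'n \<Rightarrow> real"
    have [measurable]: "Q \<in> sets lebesgue" using Q by (rule sets_cubes)
    define M where "M = measure lebesgue Q powr \<theta>"
    have M: "0 < M" using measure_cubes_pos[OF Q] by (simp add: M_def)
    obtain k where k: "0 < k" "var_norm q ?I = ennreal k" using indicator_var_norm[OF pq'(4) Q] .
    \<comment> \<open>A scale strictly above the norm k is called for. This 2, the 2 of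
      \<open>modular_indicator_le\<close> and the 2 of \<open>deviation_eq_commutator\<close> make
      up the constant 8 C.\<close>
    have "modular q ?I (2 * k) \<le> 1"
      using k by (intro modular_le_1I[OF pq'(4)]) (auto intro: ennreal_lessI)
    then have "modular p ?I (2 * (2 * k) * M) \<le> 1"
      unfolding M_def using k by (intro modular_indicator_le[OF Q pq'(3,4,1,5)]) auto
    from C(2)[OF _ _ this] have T: "finite_ae (commutator_sharp b ?I)"
      "modular q (\<lambda>x. real_of_ereal (commutator_sharp b ?I x)) (C * (2 * (2 * k) * M)) \<le> 1"
      using k M by auto
    have dev: "AE x in lebesgue. \<bar>deviation b Q x\<bar> \<noteq> \<infinity> \<and>
      \<bar>real_of_ereal (deviation b Q x)\<bar> \<le> 2 * \<bar>real_of_ereal (commutator_sharp b ?I x)\<bar>"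
      using T(1) unfolding finite_ae_def
    proof eventually_elim
      case (elim x)
      show ?case
      proof (cases "x \<in> Q")
        case True
        then show ?thesis
          using elim by (cases "commutator_sharp b ?I x") (auto simp: deviation_eq_commutator[OF Q] abs_mult numeral_eq_ereal)
      qed (simp add: deviation_def real_of_ereal_pos)
    qed
    have "modular q (\<lambda>x. real_of_ereal (deviation b Q x)) (8 * C * k * M) \<le> modular q (\<lambda>x. real_of_ereal (commutator_sharp b ?I x)) (C * (2 * (2 * k) * M))"
    proof (rule modular_mono_AE[OF _ _ pq'(4)])
      show "AE x in lebesgue. \<bar>real_of_ereal (deviation b Q x)\<bar> / (8 * C * k * M) \<le> \<bar>real_of_ereal (commutator_sharp b ?I x)\<bar> / (C * (2 * (2 * k) * M))"
        using dev by eventually_elim (use C k M in \<open>auto simp: field_simps\<close>)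
    qed (use C k M in simp)
    then have "var_norm q (\<lambda>x. real_of_ereal (deviation b Q x)) \<le> ennreal (8 * C * k * M)"
      using T(2) C k M by (intro var_norm_le deviation_measurable[OF b Q]) auto
    moreover have "finite_ae (deviation b Q)" using dev unfolding finite_ae_def by eventually_elim simp
    ultimately have "var_norm_ereal q (deviation b Q) \<le> ennreal (8 * C * k * M)"
      by (simp add: var_norm_ereal_def)
    then have "1 / ennreal M * (var_norm_ereal q (deviation b Q) / ennreal k) \<le> 1 / ennreal M * (ennreal (8 * C * k * M) / ennreal k)"
      by (intro mult_left_mono divide_right_mono_ennreal) auto
    also have "\<dots> = ennreal (8 * C)"
      using C k M by (simp add: divide_ennreal flip: ennreal_1 ennreal_mult)
    finally show ?thesis unfolding k(2) M_def .
  qed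
  then have "sharp_deviation \<beta> b q \<le> ennreal (8 * C)"
    unfolding sharp_deviation_eq by (intro SUP_least) (simp add: \<theta>_def)
  then show ?thesis by (rule le_less_trans) simp
qed

text \<open>Takes the place of a duality argument: the constant c = \<open>avg Q h\<close> is a
  lower bound on the cube for the maximal function of h. Hence c times the norm of the indicator is
  at most the bound for the norm of that maximal function.\<close>

lemma sharp_deviation_imp_avg_bound:
  fixes b :: "real ^ 'n \<Rightarrow> real"
  assumes b: "b \<in> borel_measurable lebesgue" and \<beta>: "\<beta> < 1" and pq: "(p, q) \<in> exponent_pairs \<beta>"
    and dev: "sharp_deviation \<beta> b q < \<infinity>"
  obtains A where "0 < A"
    "\<And>Q. Q \<in> cubes \<Longrightarrow> finite_ae (deviation b Q) \<and>
       avg Q (\<lambda>x. real_of_ereal (deviation b Q x)) \<le> ennreal (A * measure lebesgue Q powr (\<beta> / CARD('n)))"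
proof -
  define \<theta> where "\<theta> = \<beta> / CARD('n)"
  note pq' = exponent_pairsD[OF pq \<beta>, folded \<theta>_def]
  obtain C where C: "0 < C" "\<And>h s. h \<in> borel_measurable lebesgue \<Longrightarrow> 0 < s \<Longrightarrow> modular q h s \<le> 1 \<Longrightarrow>
      \<exists>G. G \<in> borel_measurable lebesgue \<and> (\<forall>x. 0 \<le> G x) \<and> modular q G (C * s) \<le> 1 \<and>
        (AE x in lebesgue. maximal h x \<le> ennreal (G x))"
    using maximal_modular_bound[OF pq'(1,2,6)] by blast
  obtain D where D: "0 \<le> D" "sharp_deviation \<beta> b q = ennreal D"
    using dev by (cases "sharp_deviation \<beta> b q") auto
  show thesis
  proof (rule that[of "C * (D + 1)"])
    show "0 < C * (D + 1)" using C D by simp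
    fix Q :: "(real ^ 'n) set" assume Q: "Q \<in> cubes"
    let ?I = "indicator Q :: real ^ 'n \<Rightarrow> real"
    have [measurable]: "Q \<in> sets lebesgue" using Q by (rule sets_cubes)
    define M where "M = measure lebesgue Q powr \<theta>"
    have M: "0 < M" using measure_cubes_pos[OF Q] by (simp add: M_def)
    obtain k where k: "0 < k" "var_norm q ?I = ennreal k" using indicator_var_norm[OF pq'(4) Q] .
    define N where "N = var_norm_ereal q (deviation b Q)"
    have "1 / ennreal M * (N / ennreal k) \<le> ennreal D"
      unfolding D(2)[symmetric] sharp_deviation_eq N_def k(2)[symmetric] M_def \<theta>_def
      by (rule SUP_upper) (rule Q)
    then have "ennreal (M * k) * (1 / ennreal M * (N / ennreal k)) \<le> ennreal (M * k) * ennreal D"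
      by (rule mult_left_mono) simp
    moreover have "ennreal (M * k) * (1 / ennreal M * (N / ennreal k)) = N"
    proof -
      have "ennreal (M * k) * (1 / ennreal M * (N / ennreal k)) = (ennreal M * (1 / ennreal M)) * (ennreal k * (N / ennreal k))"
        using M k by (simp add: ennreal_mult mult_ac)
      also have "ennreal M * (1 / ennreal M) = 1" using M by (simp add: divide_ennreal flip: ennreal_1 ennreal_mult)
      also have "ennreal k * (N / ennreal k) = N"
        using k by (simp add: ennreal_times_divide mult.commute[of "ennreal k" N] mult_divide_eq_ennreal)
      finally show ?thesis by simp
    qed
    ultimately have "N \<le> ennreal (M * k * D)" using M k D by (simp add: ennreal_mult)
    also have "\<dots> < ennreal ((D + 1) * M * k)" using M k D by (intro ennreal_lessI mult_pos_pos) (auto simp: algebra_simps)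
    finally have N: "N < ennreal ((D + 1) * M * k)" .
    then have fin: "finite_ae (deviation b Q)" by (auto simp: N_def var_norm_ereal_def split: if_splits)
    define h where "h = (\<lambda>x. real_of_ereal (deviation b Q x))"
    define s where "s = (D + 1) * M * k"
    have s: "0 < s" using M k D by (simp add: s_def)
    have hm: "h \<in> borel_measurable lebesgue" unfolding h_def by (rule deviation_measurable[OF b Q])
    have "modular q h s \<le> 1"
      using N fin by (intro modular_le_1I[OF pq'(4)]) (simp add: N_def var_norm_ereal_def h_def s_def)
    then obtain G where G: "\<And>x. 0 \<le> G x" "modular q G (C * s) \<le> 1" "AE x in lebesgue. maximal h x \<le> ennreal (G x)"
      using C(2)[OF hm s] by blast
    have avG: "AE x in lebesgue. x \<in> Q \<longrightarrow> avg Q h \<le> ennreal (G x)"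
      using G(3) by eventually_elim (auto intro: order_trans[OF avg_le_maximal[OF Q]])
    obtain x0 where "avg Q h \<le> ennreal (G x0)" using AE_cubes_ex[OF avG Q] by auto
    then obtain c where c: "avg Q h = ennreal c" "0 \<le> c" by (cases "avg Q h") (auto simp: top_unique)
    have "c \<le> C * (D + 1) * M"
    proof (cases "c = 0")
      case True
      then show ?thesis using C D M by simp
    next
      case False
      then have c0: "0 < c" using c by simp
      have "modular q ?I (C * s / c) \<le> modular q G (C * s)"
      proof (rule modular_mono_AE[OF _ _ pq'(4)])
        show "AE x in lebesgue. \<bar>?I x\<bar> / (C * s / c) \<le> \<bar>G x\<bar> / (C * s)"
          using avG
        proof eventually_elim
          case (elim x)
          then show ?case using C s c0 G(1)[of x] by (auto simp: c indicator_def divide_right_mono)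
        qed
      qed (use C s c0 in simp)
      then have "var_norm q ?I \<le> ennreal (C * s / c)"
        using G(2) C s c0 by (intro var_norm_le) auto
      then have "k \<le> C * s / c" using k C s c0 by (subst (asm) k(2), subst (asm) ennreal_le_iff) auto
      \<comment> \<open>The scale s contains the factor k, so the norm of the indicator
        cancels.\<close>
      then have "k * c \<le> k * (C * (D + 1) * M)" using c0 by (simp add: s_def field_simps)
      then show ?thesis using k by simp
    qed
    then show "finite_ae (deviation b Q) \<and>
       avg Q (\<lambda>x. real_of_ereal (deviation b Q x)) \<le> ennreal (C * (D + 1) * measure lebesgue Q powr (\<beta> / CARD('n)))"
      using fin c by (simp add: h_def M_def \<theta>_def ennreal_leI)
  qed
qed

section \<open>Campanato's characterization\<close>

definition ccube :: "real ^ 'n \<Rightarrow> real \<Rightarrow> (real ^ 'n) set" where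
  "ccube x l = cube (\<chi> i. x $ i - l / 2) l"

lemma mem_ccube: "y \<in> ccube x l \<longleftrightarrow> (\<forall>i. \<bar>y $ i - x $ i\<bar> < l / 2)"
  by (auto simp: ccube_def mem_cube abs_less_iff field_simps; (smt (verit) field_sum_of_halves))

lemma ccube_mono: "l' \<le> l \<Longrightarrow> ccube x l' \<subseteq> ccube x l"
  by (rule subsetI) (unfold mem_ccube, meson divide_right_mono less_le_trans zero_le_numeral)

lemma ccube_in_cubes: "0 < l \<Longrightarrow> ccube x l \<in> cubes"
  by (simp add: ccube_def cube_in_cubes)

lemma avg_subset:
  assumes Q: "Q \<in> cubes" "Q' \<in> cubes" "Q \<subseteq> Q'"
  shows "avg Q f \<le> ennreal (measure lebesgue Q' / measure lebesgue Q) * avg Q' f"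
proof -
  let ?M = "measure lebesgue Q" and ?M' = "measure lebesgue Q'"
  have M: "0 < ?M" "0 < ?M'" using measure_cubes_pos Q by auto
  have "(\<integral>\<^sup>+y\<in>Q. ennreal \<bar>f y\<bar> \<partial>lebesgue) \<le> (\<integral>\<^sup>+y\<in>Q'. ennreal \<bar>f y\<bar> \<partial>lebesgue)"
    using Q(3) by (intro nn_integral_mono) (auto simp: indicator_def)
  also have "\<dots> = avg Q' f * ennreal ?M'"
    using nn_integral_eq_avg[OF Q(2)] emeasure_cubes[OF Q(2)] by simp
  finally have "avg Q f \<le> avg Q' f * ennreal ?M' / ennreal ?M"
    unfolding avg_def[of Q] emeasure_cubes[OF Q(1)] by (rule divide_right_mono_ennreal)
  also have "\<dots> = avg Q' f * (ennreal ?M' / ennreal ?M)" by (simp add: ennreal_times_divide)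
  also have "ennreal ?M' / ennreal ?M = ennreal (?M' / ?M)" using M by (intro divide_ennreal) auto
  finally show ?thesis by (simp add: mult.commute)
qed

lemma measure_cube_ratio:
  assumes "0 < l" "l' \<le> 4 * l" "0 < l'"
  shows "measure lebesgue (cube a' l' :: (real ^ 'n) set) / measure lebesgue (cube a l :: (real ^ 'n) set) \<le> 4 ^ CARD('n)"
proof -
  have "(l' / l) ^ CARD('n) \<le> 4 ^ CARD('n)" using assms by (intro power_mono) (auto simp: divide_le_eq)
  then show ?thesis using assms by (simp add: measure_cube power_divide)
qed

text \<open>The difference of means is the mean over the small cube of b minus the large mean.
  Enlarging the cube costs the volume ratio, at most 4^n.\<close>

lemma mean_nested:
  fixes b :: "real ^ 'n \<Rightarrow> real"
  assumes b: "locally_integrable b" and A: "0 \<le> A" "\<And>a l. 0 < l \<Longrightarrow> osc (cube a l) b \<le> ennreal (A * l powr \<beta>)"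
    and l: "0 < l" "l \<le> l'" "l' \<le> 4 * l" and sub: "cube a l \<subseteq> cube a' l'"
  shows "\<bar>mean (cube a l) b - mean (cube a' l') b\<bar> \<le> 4 ^ CARD('n) * A * l' powr \<beta>"
proof -
  have l': "0 < l'" using l by simp
  note Q = cube_in_cubes[OF l(1), of a] and Q' = cube_in_cubes[OF l', of a']
  let ?m = "mean (cube a' l') b"
  note bm [measurable] = locally_integrableD(1)[OF b]
  have "mean (cube a l) b - ?m = mean (cube a l) (\<lambda>y. b y - ?m)"
    using locally_integrableD(2)[OF b Q] avg_const[OF Q] by (subst mean_diff[OF Q]) (auto simp: mean_const[OF Q])
  then have "ennreal \<bar>mean (cube a l) b - ?m\<bar> \<le> avg (cube a l) (\<lambda>y. b y - ?m)"
    using abs_mean_le_avg[OF Q, of "\<lambda>y. b y - ?m"] by simp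
  also have "\<dots> \<le> ennreal (measure lebesgue (cube a' l') / measure lebesgue (cube a l)) * osc (cube a' l') b"
    unfolding osc_def by (rule avg_subset[OF Q Q' sub])
  also have "\<dots> \<le> ennreal (4 ^ CARD('n)) * ennreal (A * l' powr \<beta>)"
    using measure_cube_ratio[OF l(1,3) l'] by (intro mult_mono A l' ennreal_leI) auto
  also have "\<dots> = ennreal (4 ^ CARD('n) * A * l' powr \<beta>)"
    using A by (simp add: mult.assoc flip: ennreal_mult)
  finally show ?thesis using A by (subst (asm) ennreal_le_iff) auto
qed

text \<open>Halving the side repeatedly compares means at arbitrary scales. The errors at sides l,
  l/2, l/4, ... form a geometric series, so the constant does not depend on the number j of steps in
  the induction.\<close>

lemma mean_ccube_scales:
  fixes b :: "real ^ 'n \<Rightarrow> real"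
  assumes b: "locally_integrable b" and \<beta>: "0 < \<beta>"
    and A: "0 \<le> A" "\<And>a l. 0 < l \<Longrightarrow> osc (cube a l) b \<le> ennreal (A * l powr \<beta>)"
    and l: "0 < l'" "l' \<le> l"
  shows "\<bar>mean (ccube x l') b - mean (ccube x l) b\<bar> \<le> 4 ^ CARD('n) * A / (1 - 2 powr -\<beta>) * l powr \<beta>"
proof -
  define D where "D = 4 ^ CARD('n) * A"
  define e where "e = (2 :: real) powr -\<beta>"
  have e: "0 < e" "e < 1" using \<beta> by (auto simp: e_def powr_less_one)
  \<comment> \<open>The sum of the series with ratio e and first term D; K e + D = K closes the
    induction.\<close>
  define K where "K = D / (1 - e)"
  have D: "0 \<le> D" using A by (simp add: D_def)
  have K: "0 \<le> K" "K * e + D = K" using e D by (auto simp: K_def field_simps)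
  have DK: "D \<le> K" using K e D by (simp add: K_def field_simps)
  let ?M = "\<lambda>l. mean (ccube x l) b"
  have near: "\<bar>?M l' - ?M l\<bar> \<le> D * l powr \<beta>" if "0 < l'" "l' \<le> l" "l \<le> 4 * l'" for l l'
    unfolding ccube_def D_def
  proof (rule mean_nested[OF b A that])
    show "cube (\<chi> i. x $ i - l' / 2) l' \<subseteq> cube (\<chi> i. x $ i - l / 2) l"
      using ccube_mono[OF that(2), of x] by (simp add: ccube_def)
  qed
  have dyadic: "l' \<le> l \<Longrightarrow> l \<le> 2 ^ j * l' \<Longrightarrow> \<bar>?M l' - ?M l\<bar> \<le> K * l powr \<beta>" for j l
  proof (induction j arbitrary: l)
    case 0
    then have "l = l'" by simp
    then show ?case using K by simp
  next
    case (Suc j)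
    show ?case
    proof (cases "l \<le> 2 * l'")
      case True
      then have "\<bar>?M l' - ?M l\<bar> \<le> D * l powr \<beta>" using Suc.prems l by (intro near) auto
      also have "\<dots> \<le> K * l powr \<beta>" using DK by (intro mult_right_mono) auto
      finally show ?thesis .
    next
      case False
      then have l0: "0 < l" using l by simp
      have "\<bar>?M l' - ?M (l / 2)\<bar> \<le> K * (l / 2) powr \<beta>"
        using Suc.prems False by (intro Suc.IH) auto
      moreover have "\<bar>?M (l / 2) - ?M l\<bar> \<le> D * l powr \<beta>" using l0 by (intro near) auto
      ultimately have "\<bar>?M l' - ?M l\<bar> \<le> K * (l / 2) powr \<beta> + D * l powr \<beta>" by linarith
      also have "(l / 2) powr \<beta> = e * l powr \<beta>"
        using l0 by (simp add: e_def powr_divide powr_minus field_simps)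
      also have "K * (e * l powr \<beta>) + D * l powr \<beta> = (K * e + D) * l powr \<beta>" by (simp add: algebra_simps)
      finally show ?thesis using K by simp
    qed
  qed
  obtain j where "l / l' < 2 ^ j" using real_arch_pow[of 2 "l / l'"] by auto
  then have "l \<le> 2 ^ j * l'" using l by (simp add: divide_less_eq)
  from dyadic[OF l(2) this] show ?thesis by (simp add: K_def D_def e_def)
qed

text \<open>Does the work of Lebesgue's differentiation theorem. Cover a cube by N^n cubes of side 2
  l/N: the volumes add up to a constant, while the bound on each average is of order N^(-\<beta>).
  Hence the integral of |h| vanishes.\<close>

lemma zero_AE_if_avg_small:
  fixes h :: "real ^ 'n \<Rightarrow> real"
  assumes h [measurable]: "h \<in> borel_measurable lebesgue" and \<beta>: "0 < \<beta>" and E: "0 \<le> E"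
    and avg: "\<And>a l. 0 < l \<Longrightarrow> avg (cube a l) h \<le> ennreal (E * l powr \<beta>)"
  shows "AE x in lebesgue. h x = 0"
proof -
  have zero: "(\<integral>\<^sup>+y\<in>cube a l. ennreal \<bar>h y\<bar> \<partial>lebesgue) = 0" if l: "0 < l" for a l
  proof -
    have le: "(\<integral>\<^sup>+y\<in>cube a l. ennreal \<bar>h y\<bar> \<partial>lebesgue)
      \<le> ennreal (E * 2 powr \<beta> * (2 * l) ^ CARD('n) * (l / real (Suc k)) powr \<beta>)" for k
    proof -
      define N where "N = Suc k"
      define s where "s = l / real N"
      have s: "0 < s" using l by (simp add: s_def N_def)
      define V where "V = (PiE UNIV (\<lambda>_ :: 'n. {..<N}))"
      have V: "finite V" "card V = N ^ CARD('n)" by (auto simp: V_def finite_PiE card_PiE)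
      \<comment> \<open>Open grid cells of side s would miss their faces. Cells moved back by s/2
        and of side 2 s overlap and do cover.\<close>
      define q where "q = (\<lambda>v :: 'n \<Rightarrow> nat. cube (\<chi> i. a $ i + s * real (v i) - s / 2) (2 * s))"
      have q: "q v \<in> cubes" for v using s by (simp add: q_def cube_in_cubes)
      have [measurable]: "q v \<in> sets lebesgue" for v using q by (rule sets_cubes)
      have cover: "cube a l \<subseteq> (\<Union>v\<in>V. q v)"
      proof
        fix x assume x: "x \<in> cube a l"
        define v where "v = (\<lambda>i. nat \<lfloor>(x $ i - a $ i) / s\<rfloor>)"
        have v: "real (v i) \<le> (x $ i - a $ i) / s" "(x $ i - a $ i) / s < real (v i) + 1" "v i < N" for i
        proof -
          have xi: "0 < x $ i - a $ i" "x $ i - a $ i < l" using x by (auto simp: mem_cube algebra_simps)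
          then have "0 \<le> (x $ i - a $ i) / s" using s by simp
          then show 1: "real (v i) \<le> (x $ i - a $ i) / s" "(x $ i - a $ i) / s < real (v i) + 1"
            unfolding v_def by linarith+
          have "(x $ i - a $ i) / s < l / s" using xi s by (intro divide_strict_right_mono)
          also have "\<dots> = real N" using l by (simp add: s_def N_def)
          finally show "v i < N" using 1 by linarith
        qed
        have "x \<in> q v" unfolding q_def mem_cube
        proof
          fix i
          have "s * real (v i) \<le> x $ i - a $ i" "x $ i - a $ i < s * real (v i) + s"
            using v(1,2)[of i] s by (auto simp: field_simps)
          then show "(\<chi> i. a $ i + s * real (v i) - s / 2) $ i < x $ i \<and>
            x $ i < (\<chi> i. a $ i + s * real (v i) - s / 2) $ i + 2 * s" using s by simp
        qed
        moreover have "v \<in> V" using v(3) by (simp add: V_def PiE_def)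
        ultimately show "x \<in> (\<Union>v\<in>V. q v)" by blast
      qed
      have "(\<integral>\<^sup>+y\<in>cube a l. ennreal \<bar>h y\<bar> \<partial>lebesgue) \<le> (\<integral>\<^sup>+y. (\<Sum>v\<in>V. ennreal \<bar>h y\<bar> * indicator (q v) y) \<partial>lebesgue)"
      proof (rule nn_integral_mono)
        fix y
        show "ennreal \<bar>h y\<bar> * indicator (cube a l) y \<le> (\<Sum>v\<in>V. ennreal \<bar>h y\<bar> * indicator (q v) y)"
        proof (cases "y \<in> cube a l")
          case True
          then obtain v where v: "v \<in> V" "y \<in> q v" using cover by auto
          have "ennreal \<bar>h y\<bar> * indicator (q v) y \<le> (\<Sum>v\<in>V. ennreal \<bar>h y\<bar> * indicator (q v) y)"
            by (rule member_le_sum[OF v(1) _ V(1)]) auto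
          then show ?thesis using True v by simp
        qed simp
      qed
      also have "\<dots> = (\<Sum>v\<in>V. (\<integral>\<^sup>+y\<in>q v. ennreal \<bar>h y\<bar> \<partial>lebesgue))"
        by (rule nn_integral_sum) measurable
      also have "\<dots> \<le> (\<Sum>v\<in>V. ennreal (E * (2 * s) powr \<beta> * (2 * s) ^ CARD('n)))"
      proof (rule sum_mono)
        fix v
        have "(\<integral>\<^sup>+y\<in>q v. ennreal \<bar>h y\<bar> \<partial>lebesgue) = avg (q v) h * ennreal ((2 * s) ^ CARD('n))"
          using nn_integral_eq_avg[OF q[of v], of h] s by (simp add: q_def emeasure_cube)
        also have "\<dots> \<le> ennreal (E * (2 * s) powr \<beta>) * ennreal ((2 * s) ^ CARD('n))"
          unfolding q_def using s by (intro mult_right_mono avg) auto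
        also have "\<dots> = ennreal (E * (2 * s) powr \<beta> * (2 * s) ^ CARD('n))"
          using E s by (simp flip: ennreal_mult)
        finally show "(\<integral>\<^sup>+y\<in>q v. ennreal \<bar>h y\<bar> \<partial>lebesgue) \<le> ennreal (E * (2 * s) powr \<beta> * (2 * s) ^ CARD('n))" .
      qed
      also have "\<dots> = ennreal (real (N ^ CARD('n)) * (E * (2 * s) powr \<beta> * (2 * s) ^ CARD('n)))"
        using E s by (simp add: V ennreal_of_nat_eq_real_of_nat flip: ennreal_mult)
      also have "real (N ^ CARD('n)) * (E * (2 * s) powr \<beta> * (2 * s) ^ CARD('n))
        = E * (2 * s) powr \<beta> * (real N * (2 * s)) ^ CARD('n)"
        by (simp add: power_mult_distrib)
      also have "real N * (2 * s) = 2 * l" by (simp add: s_def N_def)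
      also have "(2 * s) powr \<beta> = 2 powr \<beta> * s powr \<beta>" by (rule powr_mult)
      finally show ?thesis by (simp add: s_def N_def mult_ac)
    qed
    have "(\<lambda>k. l / real (Suc k)) \<longlonglongrightarrow> 0" by (rule LIMSEQ_Suc[OF lim_const_over_n])
    then have "(\<lambda>k. (l / real (Suc k)) powr \<beta>) \<longlonglongrightarrow> 0 powr \<beta>"
      using \<beta> l by (intro tendsto_powr') auto
    then have "(\<lambda>k. ennreal (E * 2 powr \<beta> * (2 * l) ^ CARD('n) * (l / real (Suc k)) powr \<beta>)) \<longlonglongrightarrow> ennreal (E * 2 powr \<beta> * (2 * l) ^ CARD('n) * 0)"
      by (intro tendsto_ennrealI tendsto_mult tendsto_const) simp
    then have "(\<integral>\<^sup>+y\<in>cube a l. ennreal \<bar>h y\<bar> \<partial>lebesgue) \<le> ennreal (E * 2 powr \<beta> * (2 * l) ^ CARD('n) * 0)"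
      by (rule LIMSEQ_le_const) (use le in auto)
    then show ?thesis by simp
  qed
  define Q where "Q = (\<lambda>k. ccube (0 :: real ^ 'n) (real (Suc k)))"
  have Q: "Q k \<in> cubes" for k by (simp add: Q_def ccube_in_cubes)
  have [measurable]: "Q k \<in> sets lebesgue" for k using Q by (rule sets_cubes)
  have "AE x in lebesgue. x \<in> Q k \<longrightarrow> h x = 0" for k
  proof -
    have "(\<integral>\<^sup>+y. ennreal \<bar>h y\<bar> * indicator (Q k) y \<partial>lebesgue) = 0"
      unfolding Q_def ccube_def by (rule zero) simp
    then have "AE x in lebesgue. ennreal \<bar>h x\<bar> * indicator (Q k) x = 0"
      by (subst (asm) nn_integral_0_iff_AE) auto
    then show ?thesis by eventually_elim (auto simp: indicator_def)
  qed
  then have "AE x in lebesgue. \<forall>k. x \<in> Q k \<longrightarrow> h x = 0" unfolding AE_all_countable by blast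
  then show ?thesis
  proof eventually_elim
    case (elim x)
    define k where "k = nat \<lceil>2 * norm x\<rceil>"
    have "2 * norm x < real (Suc k)" unfolding k_def by linarith
    then have "norm x < real (Suc k) / 2" by simp
    then have "\<bar>x $ i\<bar> < real (Suc k) / 2" for i by (rule le_less_trans[OF component_le_norm_cart])
    then have "x \<in> Q k" by (simp add: Q_def mem_ccube)
    then show ?case using elim by blast
  qed
qed

lemma Hoelder_borel_measurable:
  fixes g :: "real ^ 'n \<Rightarrow> real"
  assumes "0 < \<beta>" "\<And>x y. \<bar>g x - g y\<bar> \<le> K * norm (x - y) powr \<beta>"
  shows "g \<in> borel_measurable borel"
proof (rule borel_measurable_continuous_onI)
  show "continuous_on UNIV g"
    unfolding continuous_on_def
  proof (intro ballI)
    fix x :: "real ^ 'n"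
    have "((\<lambda>y. K * norm (y - x) powr \<beta>) \<longlongrightarrow> K * norm (x - x) powr \<beta>) (at x)"
      using assms(1) by (intro tendsto_intros tendsto_powr') auto
    then have "((\<lambda>y. K * norm (y - x) powr \<beta>) \<longlongrightarrow> 0) (at x)" using assms(1) by simp
    then have "((\<lambda>y. g y - g x) \<longlongrightarrow> 0) (at x)"
      by (rule Lim_null_comparison[rotated]) (auto intro!: always_eventually assms(2))
    then show "(g \<longlongrightarrow> g x) (at x within UNIV)" by (simp add: LIM_zero_iff)
  qed
qed

text \<open>The representative g is the limit of means over centred cubes of side 1/(k+1), a Cauchy
  sequence by \<open>mean_ccube_scales\<close>. The limit is part of the conclusion because the sign
  of g is read off from it.\<close>

lemma Campanato:
  fixes b :: "real ^ 'n \<Rightarrow> real"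
  assumes b: "locally_integrable b" and \<beta>: "0 < \<beta>"
    and A: "0 \<le> A" "\<And>a l. 0 < l \<Longrightarrow> osc (cube a l) b \<le> ennreal (A * l powr \<beta>)"
  shows "\<exists>g K. (AE x in lebesgue. b x = g x) \<and> (\<forall>x y. \<bar>g x - g y\<bar> \<le> K * norm (x - y) powr \<beta>) \<and>
    (\<forall>x. (\<lambda>k. mean (ccube x (1 / real (Suc k))) b) \<longlonglongrightarrow> g x)"
proof -
  define K where "K = 4 ^ CARD('n) * A / (1 - 2 powr -\<beta>)"
  have "(2 :: real) powr -\<beta> < 1" using \<beta> by (simp add: powr_less_one)
  then have K: "0 \<le> K" using A by (simp add: K_def)
  note scales = mean_ccube_scales[OF b \<beta> A, folded K_def]
  let ?M = "\<lambda>x k. mean (ccube x (1 / real (Suc k))) b"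
  have lim0: "(\<lambda>k. K * (1 / real (Suc k)) powr \<beta>) \<longlonglongrightarrow> 0"
  proof -
    have "(\<lambda>k. 1 / real (Suc k)) \<longlonglongrightarrow> 0" by (rule LIMSEQ_Suc[OF lim_const_over_n])
    then have "(\<lambda>k. K * (1 / real (Suc k)) powr \<beta>) \<longlonglongrightarrow> K * 0 powr \<beta>"
      using \<beta> by (intro tendsto_mult tendsto_const tendsto_powr') auto
    then show ?thesis by simp
  qed
  have "Cauchy (?M x)" for x
  proof (rule CauchyI')
    fix e :: real assume "0 < e"
    then obtain k0 where k0: "\<And>k. k0 \<le> k \<Longrightarrow> K * (1 / real (Suc k)) powr \<beta> < e"
      using order_tendstoD(2)[OF lim0] by (auto simp: eventually_sequentially)
    show "\<exists>M. \<forall>m\<ge>M. \<forall>n>m. dist (?M x m) (?M x n) < e"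
    proof (intro exI[of _ k0] allI impI)
      fix m n assume "k0 \<le> m" "m < n"
      then have "\<bar>?M x n - ?M x m\<bar> \<le> K * (1 / real (Suc m)) powr \<beta>"
        by (intro scales) (auto intro: divide_left_mono)
      also have "\<dots> < e" by (rule k0) fact
      finally show "dist (?M x m) (?M x n) < e" by (simp add: dist_real_def abs_minus_commute)
    qed
  qed
  then have conv: "convergent (?M x)" for x by (simp add: Cauchy_convergent_iff)
  define g where "g = (\<lambda>x. lim (?M x))"
  have g: "?M x \<longlonglongrightarrow> g x" for x using conv[of x] by (simp add: g_def convergent_LIMSEQ_iff)
  have near: "\<bar>g x - mean (ccube x l) b\<bar> \<le> K * l powr \<beta>" if l: "0 < l" for x l
  proof (rule LIMSEQ_le_const2)
    show "(\<lambda>k. \<bar>?M x k - mean (ccube x l) b\<bar>) \<longlonglongrightarrow> \<bar>g x - mean (ccube x l) b\<bar>"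
      by (intro tendsto_intros g)
    have "(\<lambda>k. 1 / real (Suc k)) \<longlonglongrightarrow> 0" by (rule LIMSEQ_Suc[OF lim_const_over_n])
    then have "eventually (\<lambda>k. 1 / real (Suc k) < l) sequentially" using l by (rule order_tendstoD(2))
    then obtain k0 where k0: "\<And>k. k0 \<le> k \<Longrightarrow> 1 / real (Suc k) < l" by (auto simp: eventually_sequentially)
    show "\<exists>N. \<forall>n\<ge>N. \<bar>?M x n - mean (ccube x l) b\<bar> \<le> K * l powr \<beta>"
    proof (intro exI[of _ k0] allI impI)
      fix n assume "k0 \<le> n"
      then show "\<bar>?M x n - mean (ccube x l) b\<bar> \<le> K * l powr \<beta>"
        using less_imp_le[OF k0[of n]] by (intro scales) simp_all
    qed
  qed
  define D where "D = 4 ^ CARD('n) * A"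
  have D: "0 \<le> D" using A by (simp add: D_def)
  define K2 where "K2 = (K + D) * 2 powr \<beta>"
  have K2: "0 \<le> K2" using K D by (simp add: K2_def)
  \<comment> \<open>A cube of side l containing x lies in the cube centred at x of side 2 l, whose
    mean is already compared with g x.\<close>
  have cube: "\<bar>g x - mean (cube a l) b\<bar> \<le> K2 * l powr \<beta>" if l: "0 < l" and x: "x \<in> cube a l" for x a l
  proof -
    have "cube a l \<subseteq> ccube x (2 * l)"
    proof
      fix y assume "y \<in> cube a l"
      then have "\<bar>y $ i - x $ i\<bar> < l" for i using x unfolding mem_cube by (smt (verit))
      then show "y \<in> ccube x (2 * l)" by (simp add: mem_ccube)
    qed
    then have "\<bar>mean (cube a l) b - mean (ccube x (2 * l)) b\<bar> \<le> D * (2 * l) powr \<beta>"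
      unfolding ccube_def D_def using l by (intro mean_nested[OF b A]) auto
    moreover have "\<bar>g x - mean (ccube x (2 * l)) b\<bar> \<le> K * (2 * l) powr \<beta>" using l by (intro near) auto
    ultimately have "\<bar>g x - mean (cube a l) b\<bar> \<le> K * (2 * l) powr \<beta> + D * (2 * l) powr \<beta>" by linarith
    then show ?thesis by (simp add: K2_def powr_mult algebra_simps)
  qed
  define L where "L = 2 * K2 * 4 powr \<beta>"
  have hoelder: "\<bar>g x - g y\<bar> \<le> L * norm (x - y) powr \<beta>" for x y
  proof (cases "x = y")
    case False
    define d where "d = norm (x - y)"
    have d: "0 < d" using False by (simp add: d_def)
    have "norm (y - x) = d" by (simp add: d_def norm_minus_commute)
    then have "\<bar>(y - x) $ i\<bar> < 2 * d" for i
      using component_le_norm_cart[of "y - x" i] d by linarith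
    \<comment> \<open>One cube of side comparable to |x - y| contains both points, so both values of
      g are compared with the same mean.\<close>
    then have "x \<in> ccube x (4 * d)" "y \<in> ccube x (4 * d)" using d by (auto simp: mem_ccube)
    then have "\<bar>g x - mean (ccube x (4 * d)) b\<bar> \<le> K2 * (4 * d) powr \<beta>"
      "\<bar>g y - mean (ccube x (4 * d)) b\<bar> \<le> K2 * (4 * d) powr \<beta>"
      using d unfolding ccube_def by (auto intro!: cube)
    then have "\<bar>g x - g y\<bar> \<le> 2 * (K2 * (4 * d) powr \<beta>)" by linarith
    then show ?thesis by (simp add: L_def d_def powr_mult mult_ac)
  qed simp
  note bm [measurable] = locally_integrableD(1)[OF b]
  have gm [measurable]: "g \<in> borel_measurable lebesgue"
    using Hoelder_borel_measurable[OF \<beta> hoelder] by (auto intro: measurable_completion)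
  \<comment> \<open>On every cube both b and g are within order l^\<beta> of the mean of b, the
    former on average.\<close>
  have "AE x in lebesgue. b x - g x = 0"
  proof (rule zero_AE_if_avg_small[OF _ \<beta>])
    show "0 \<le> A + K2" using A K2 by simp
    fix a :: "real ^ 'n" and l :: real assume l: "0 < l"
    note Q = cube_in_cubes[OF l, of a]
    have "avg (cube a l) (\<lambda>x. b x - g x) \<le> osc (cube a l) b + avg (cube a l) (\<lambda>_. K2 * l powr \<beta>)"
      unfolding osc_def
    proof (rule avg_triangle[OF Q])
      fix x assume "x \<in> cube a l"
      then show "\<bar>b x - g x\<bar> \<le> \<bar>b x - mean (cube a l) b\<bar> + \<bar>K2 * l powr \<beta>\<bar>"
        using cube[OF l] by fastforce
    qed auto
    also have "\<dots> \<le> ennreal (A * l powr \<beta>) + ennreal (K2 * l powr \<beta>)"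
      using K2 by (intro add_mono A l) (simp add: avg_const[OF Q])
    also have "\<dots> = ennreal ((A + K2) * l powr \<beta>)"
      using A K2 by (simp add: algebra_simps flip: ennreal_plus)
    finally show "avg (cube a l) (\<lambda>x. b x - g x) \<le> ennreal ((A + K2) * l powr \<beta>)" .
  qed measurable
  then have "AE x in lebesgue. b x = g x" by eventually_elim simp
  then show ?thesis using hoelder g by blast
qed

section \<open>The equivalence\<close>

lemma mean_mono:
  assumes Q: "Q \<in> cubes" and f: "f \<in> borel_measurable lebesgue" and g: "g \<in> borel_measurable lebesgue"
    and fin: "avg Q f < \<infinity>" "avg Q g < \<infinity>" and le: "\<And>x. f x \<le> g x"
  shows "mean Q f \<le> mean Q g"
  unfolding mean_def using fin set_integrable_avg[OF Q f] set_integrable_avg[OF Q g] le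
  by (intro divide_right_mono set_integral_mono) auto

lemma avg_eq_mean:
  assumes Q: "Q \<in> cubes" and f: "f \<in> borel_measurable lebesgue" and fin: "avg Q f < \<infinity>" and nn: "\<And>x. 0 \<le> f x"
  shows "avg Q f = ennreal (mean Q f)"
proof -
  have int: "integrable lebesgue (\<lambda>x. indicator Q x * f x)"
    using set_integrable_avg[OF Q f] fin by (simp add: set_integrable_def)
  have "(\<integral>\<^sup>+y\<in>Q. ennreal \<bar>f y\<bar> \<partial>lebesgue) = (\<integral>\<^sup>+x. ennreal (indicator Q x * f x) \<partial>lebesgue)"
    using nn by (intro nn_integral_cong) (auto simp: indicator_def)
  also have "\<dots> = ennreal (LINT y:Q|lebesgue. f y)"
    unfolding set_lebesgue_integral_def using int nn by (subst nn_integral_eq_integral) auto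
  finally show ?thesis
    using measure_cubes_pos[OF Q] nn
    by (simp add: avg_def mean_def emeasure_cubes[OF Q] divide_ennreal set_lebesgue_integral_def)
qed

text \<open>Both estimates rest on |m| - b \<le> |h| a.e. on the cube, for the mean m of b. A
  one-sided bound suffices, since m - b has mean 0 and its positive part carries half of the
  oscillation.\<close>

lemma avg_deviation_bounds:
  fixes b :: "real ^ 'n \<Rightarrow> real"
  assumes b: "locally_integrable b" and Q: "Q \<in> cubes" and fin: "finite_ae (deviation b Q)"
  defines "h \<equiv> \<lambda>x. real_of_ereal (deviation b Q x)"
  shows "osc Q b \<le> 2 * avg Q h" "ennreal (\<bar>mean Q b\<bar> - mean Q b) \<le> avg Q h"
proof -
  define m where "m = mean Q b"
  note bm [measurable] = locally_integrableD(1)[OF b]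
  note bfin = locally_integrableD(2)[OF b Q]
  have dev: "AE x in lebesgue. x \<in> Q \<longrightarrow> \<bar>m\<bar> - b x \<le> \<bar>h x\<bar>"
    using fin unfolding finite_ae_def
  proof eventually_elim
    case (elim x)
    show ?case
    proof
      assume x: "x \<in> Q"
      let ?S = "sharp_maximal (\<lambda>y. b y * indicator Q y) x"
      have d: "deviation b Q x = ereal (b x) - 2 * enn2ereal ?S" using x by (simp add: deviation_def)
      \<comment> \<open>An infinite sharp maximal function would make the deviation -\<infinity>,
        which finiteness excludes.\<close>
      then obtain t where t: "?S = ennreal t" "0 \<le> t" using elim by (cases ?S) (auto simp: enn2ereal_top)
      have "ennreal \<bar>m\<bar> \<le> 2 * ennreal t"
        using abs_mean_le_sharp_maximal[OF Q bm x] t by (simp add: m_def)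
      also have "\<dots> = ennreal (2 * t)" using t by (simp add: ennreal_mult)
      finally have "\<bar>m\<bar> \<le> 2 * t" using t by simp
      moreover have "h x = b x - 2 * t"
        using t d by (simp add: h_def enn2ereal_ennreal numeral_eq_ereal)
      ultimately show "\<bar>m\<bar> - b x \<le> \<bar>h x\<bar>" by simp
    qed
  qed
  have le_h: "avg Q (\<lambda>x. max 0 (c - b x)) \<le> avg Q h" if "c \<le> \<bar>m\<bar>" for c
    unfolding avg_def
  proof (rule divide_right_mono_ennreal, rule nn_integral_mono_AE, use dev in eventually_elim)
    case (elim x)
    then show ?case using that by (auto simp: indicator_def intro!: ennreal_leI)
  qed
  have cfin: "avg Q (\<lambda>_. c) < \<infinity>" for c by (simp add: avg_const[OF Q])
  have pfin: "avg Q (\<lambda>x. max 0 (c - b x)) < \<infinity>" for c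
  proof -
    have "avg Q (\<lambda>x. max 0 (c - b x)) \<le> avg Q (\<lambda>_. c) + avg Q b"
      by (intro avg_triangle Q) auto
    also have "\<dots> < \<infinity>" using cfin[of c] bfin by simp
    finally show ?thesis .
  qed
  have mean_sub: "mean Q (\<lambda>x. c - b x) = c - m" for c
    using cfin[of c] bfin by (subst mean_diff[OF Q]) (auto simp: mean_const[OF Q] m_def)
  have sfin: "avg Q (\<lambda>x. c - b x) < \<infinity>" for c
    using cfin[of c] bfin by (intro avg_diff_finite Q) auto
  define u where "u = (\<lambda>x. max 0 (m - b x))"
  have [measurable]: "u \<in> borel_measurable lebesgue" by (simp add: u_def)
  \<comment> \<open>Pointwise |b - m| = 2 max(0, m - b) - (m - b), and the last term has mean
    0.\<close>
  have "osc Q b = avg Q (\<lambda>x. 2 * u x - (m - b x))"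
    unfolding osc_def m_def[symmetric] avg_def u_def
    by (intro arg_cong2[where f = "(/)"] nn_integral_cong) (auto simp: max_def)
  also have "\<dots> = ennreal (mean Q (\<lambda>x. 2 * u x - (m - b x)))"
  proof (rule avg_eq_mean[OF Q])
    show "avg Q (\<lambda>x. 2 * u x - (m - b x)) < \<infinity>"
      using pfin[of m] cfin[of m] bfin by (intro avg_diff_finite Q) (auto simp: avg_cmult[OF Q] u_def ennreal_mult_less_top)
  qed (auto simp: u_def max_def)
  also have "mean Q (\<lambda>x. 2 * u x - (m - b x)) = mean Q (\<lambda>x. 2 * u x) - mean Q (\<lambda>x. m - b x)"
    using pfin[of m] sfin[of m]
    by (intro mean_diff[OF Q]) (auto simp: avg_cmult[OF Q] u_def ennreal_mult_less_top)
  also have "\<dots> = 2 * mean Q u" by (simp add: mean_cmult mean_sub)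
  also have "ennreal (2 * mean Q u) = 2 * avg Q u"
    using avg_eq_mean[OF Q, of u] pfin[of m] by (simp add: u_def ennreal_mult')
  also have "\<dots> \<le> 2 * avg Q h" using le_h[of m] by (intro mult_left_mono) (auto simp: u_def)
  finally show "osc Q b \<le> 2 * avg Q h" .
  have "\<bar>m\<bar> - m \<le> mean Q (\<lambda>x. max 0 (\<bar>m\<bar> - b x))"
    unfolding mean_sub[symmetric] using pfin sfin by (intro mean_mono Q) auto
  then have "ennreal (\<bar>m\<bar> - m) \<le> ennreal (mean Q (\<lambda>x. max 0 (\<bar>m\<bar> - b x)))" by (rule ennreal_leI)
  also have "\<dots> = avg Q (\<lambda>x. max 0 (\<bar>m\<bar> - b x))"
    using pfin by (intro avg_eq_mean[symmetric] Q) auto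
  also have "\<dots> \<le> avg Q h" by (rule le_h) simp
  finally show "ennreal (\<bar>mean Q b\<bar> - mean Q b) \<le> avg Q h" by (simp add: m_def)
qed

lemma sharp_deviation_imp_lipschitz_nonneg:
  fixes b :: "real ^ 'n \<Rightarrow> real"
  assumes b: "locally_integrable b" and \<beta>: "\<beta> < 1" and pq: "(p, q) \<in> exponent_pairs \<beta>"
    and dev: "sharp_deviation \<beta> b q < \<infinity>"
  shows "b \<in> lipschitz_space \<beta>" "AE x in lebesgue. 0 \<le> b x"
proof -
  have \<beta>0: "0 < \<beta>" using pq by (simp add: exponent_pairs_def)
  note bm = locally_integrableD(1)[OF b]
  obtain A where A: "0 < A"
    "\<And>Q. Q \<in> cubes \<Longrightarrow> finite_ae (deviation b Q) \<and>
       avg Q (\<lambda>x. real_of_ereal (deviation b Q x)) \<le> ennreal (A * measure lebesgue Q powr (\<beta> / CARD('n)))"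
    using sharp_deviation_imp_avg_bound[OF bm \<beta> pq dev] by blast
  have m: "measure lebesgue (cube a l) powr (\<beta> / CARD('n)) = l powr \<beta>" if "0 < l" for a :: "real ^ 'n" and l
  proof -
    have "measure lebesgue (cube a l) = l powr real CARD('n)"
      using that by (simp add: measure_cube powr_realpow)
    then show ?thesis by (simp add: powr_powr)
  qed
  have avg: "avg (cube a l) (\<lambda>x. real_of_ereal (deviation b (cube a l) x)) \<le> ennreal (A * l powr \<beta>)"
    and fin: "finite_ae (deviation b (cube a l))" if "0 < l" for a l
    using A(2)[OF cube_in_cubes[OF that, of a]] m[OF that, of a] by auto
  have osc: "osc (cube a l) b \<le> ennreal (2 * A * l powr \<beta>)" if l: "0 < l" for a l
  proof -
    have "osc (cube a l) b \<le> 2 * ennreal (A * l powr \<beta>)"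
      using avg_deviation_bounds(1)[OF b cube_in_cubes[OF l] fin[OF l]] mult_left_mono[OF avg[OF l]]
      by (rule order_trans) simp
    also have "\<dots> = ennreal (2 * A * l powr \<beta>)" using A(1) by (simp add: ennreal_mult mult.assoc)
    finally show ?thesis .
  qed
  have A2: "0 \<le> 2 * A" using A(1) by simp
  obtain g K where g: "AE x in lebesgue. b x = g x"
    "\<And>x y. \<bar>g x - g y\<bar> \<le> K * norm (x - y) powr \<beta>"
    "\<And>x. (\<lambda>k. mean (ccube x (1 / real (Suc k))) b) \<longlonglongrightarrow> g x"
    using Campanato[OF b \<beta>0 A2 osc] by blast
  then show "b \<in> lipschitz_space \<beta>" unfolding lipschitz_space_def by blast
  \<comment> \<open>The excess |m| - m of the means is of order l^\<beta>. In the limit of shrinking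
    cubes this leaves |g x| \<le> g x.\<close>
  have g0: "0 \<le> g x" for x
  proof -
    let ?m = "\<lambda>k. mean (ccube x (1 / real (Suc k))) b"
    have "\<bar>?m k\<bar> - ?m k \<le> A * (1 / real (Suc k)) powr \<beta>" for k
    proof -
      have l: "0 < 1 / real (Suc k)" by simp
      have "ennreal (\<bar>?m k\<bar> - ?m k) \<le> ennreal (A * (1 / real (Suc k)) powr \<beta>)"
        unfolding ccube_def
        by (rule order_trans[OF avg_deviation_bounds(2)[OF b cube_in_cubes[OF l] fin[OF l]] avg[OF l]])
      then show ?thesis using A(1) by (subst (asm) ennreal_le_iff) auto
    qed
    moreover have "(\<lambda>k. A * (1 / real (Suc k)) powr \<beta>) \<longlonglongrightarrow> A * 0 powr \<beta>"
      using \<beta>0 LIMSEQ_Suc[OF lim_const_over_n, of 1] by (intro tendsto_mult tendsto_const tendsto_powr') auto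
    moreover have "(\<lambda>k. \<bar>?m k\<bar> - ?m k) \<longlonglongrightarrow> \<bar>g x\<bar> - g x" by (intro tendsto_intros g(3))
    ultimately have "\<bar>g x\<bar> - g x \<le> A * 0 powr \<beta>" by (intro LIMSEQ_le) auto
    then show ?thesis by simp
  qed
  show "AE x in lebesgue. 0 \<le> b x" using g(1) by eventually_elim (simp add: g0)
qed

theorem theorem1p3:
  fixes b :: "real ^ 'n \<Rightarrow> real" and \<beta> :: real
  assumes "locally_integrable b" and "0 < \<beta>" and "\<beta> < 1"
  shows
    "let A1 = (b \<in> lipschitz_space \<beta> \<and> (AE x in lebesgue. 0 \<le> b x));
         A2 = (\<forall>(p, q) \<in> exponent_pairs \<beta>. bounded_operator (commutator_sharp b) p q);
         A3 = (\<exists>(p, q) \<in> exponent_pairs \<beta>. bounded_operator (commutator_sharp b) p q);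
         A4 = (\<exists>(p, q) \<in> exponent_pairs \<beta>. sharp_deviation \<beta> b q < \<infinity>);
         A5 = (\<forall>(p, q) \<in> exponent_pairs \<beta>. sharp_deviation \<beta> b q < \<infinity>)
     in (A1 \<longleftrightarrow> A2) \<and> (A2 \<longleftrightarrow> A3) \<and> (A3 \<longleftrightarrow> A4) \<and> (A4 \<longleftrightarrow> A5)"
proof -
  let ?E = "exponent_pairs \<beta> :: ((real ^ 'n \<Rightarrow> real) \<times> (real ^ 'n \<Rightarrow> real)) set"
  let ?A1 = "b \<in> lipschitz_space \<beta> \<and> (AE x in lebesgue. 0 \<le> b x)"
  have 12: "bounded_operator (commutator_sharp b) p q" if "?A1" "(p, q) \<in> ?E" for p q
    using commutator_bounded[OF assms(1,3) that(2)] that(1) by blast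
  have 34: "sharp_deviation \<beta> b q < \<infinity>" if "bounded_operator (commutator_sharp b) p q" "(p, q) \<in> ?E" for p q
    by (rule commutator_bounded_imp_sharp_deviation[OF locally_integrableD(1)[OF assms(1)] assms(3) that(2,1)])
  have 41: "?A1" if "sharp_deviation \<beta> b q < \<infinity>" "(p, q) \<in> ?E" for p q
    using sharp_deviation_imp_lipschitz_nonneg[OF assms(1,3) that(2,1)] by blast
  \<comment> \<open>One existing pair leads from (2) to (3) and from (5) to (4). The cycle 1, 2, 3,
    4, 1 then closes, and (5) follows from (2) pair by pair.\<close>
  obtain p0 q0 where "(p0, q0) \<in> ?E" using exponent_pairs_nonempty[OF assms(2,3)] by blast
  then show ?thesis unfolding Let_def using 12 34 41 by blast
qed

end
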